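(* Let $R$ be a Baer $\ast$-ring that satisfies axioms (A1), (A2), (A3), (A4), (A5) and (A6), and let $Q$ be the regular ring of $R$. Then the following conditions are equivalent: (1) $R=Q$; (2) $R$ is von Neumann regular; (3) $R$ is unit-regular; (4) $R$ is left morphic; (5) $R$ is right morphic; (6) $R$ is left quasi-morphic; (7) $R$ is right quasi-morphic.
   Context: All rings are associative and unital; $\mathrm{ann}_r(x)$ and $\mathrm{ann}_l(x)$ denote right and left annihilators. A $\ast$-ring is a ring $R$ with a map $\ast:R\to R$ with $(x+y)^\ast=x^\ast+y^\ast$, $(xy)^\ast=y^\ast x^\ast$, $(x^\ast)^\ast=x$. A projection is an element $p$ with $p^\ast=p=p^2$; projections are ordered by $p\le q$ iff $p=pq$; orthogonal means $pq=0$. A Baer $\ast$-ring is a $\ast$-ring in which the right annihilator of every nonempty subset is generated, as a right ideal, by a projection (its projections then form a complete lattice). For $x$ in such a ring, $\mathrm{RP}(x)$ is the unique projection $p$ with $xp=x$ and $\mathrm{ann}_r(x)=(1-p)R$. For $S\subseteq R$, $S'$ is the commutant of $S$ in $R$ and $S''=(S')'$. A partial isometry is $w$ with $ww^\ast w=w$; a unitary is $u$ with $u^\ast u=uu^\ast=1$. Axioms: (A1) $R$ is finite: $x^\ast x=1$ implies $xx^\ast=1$ for all $x\in R$. (A2) consists of (EP) and (UPSR). (EP): for every $0\neq x\in R$ there is a self-adjoint $y\in\{x^\ast x\}''$ such that $(x^\ast x)y^2$ is a nonzero projection. (UPSR): call $x\in R$ positive if $x=x_1^\ast x_1+\dots+x_m^\ast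 x_m$ for some $m$ and $x_1,\dots,x_m\in R$; for every positive $x$ there is a unique $y\in\{x^\ast x\}''$ such that $y^2=x$ and $y$ is positive. (A3) Partial isometries are addable: whenever $(w_i)$ is a family of partial isometries such that the projections $e_i=w_i^\ast w_i$ are pairwise orthogonal and the projections $f_i=w_iw_i^\ast$ are pairwise orthogonal, there is a partial isometry $w$ with $w^\ast w=\sup e_i$, $ww^\ast=\sup f_i$ and $we_i=w_i=f_iw$ for all $i$. (A4) $1+x^\ast x$ is invertible for all $x\in R$. (A5) There is a central $i\in R$ with $i^2=-1$ and $i^\ast=-i$. (A6) For every unitary $u\in R$ with $\mathrm{RP}(1-u)=1$ there is an increasing sequence of projections $p_n\in\{u\}''$ with $\sup p_n=1$ such that $(1-u)p_n$ is invertible in $p_nRp_n$ for every $n$. The regular ring of $R$: by results of Berberian, a Baer $\ast$-ring $R$ satisfying (A1)--(A6) embeds as a $\ast$-subring in a von Neumann regular Baer $\ast$-ring $Q$ satisfying (A1)--(A6) such that all projections, unitaries and partial isometries of $Q$ lie in $R$, and $Q$ is unique up to $\ast$-isomorphism; $Q$ is called the regular ring of $R$. It is also the maximal (left and right) and the classical ring of quotients of $R$. A ring $R$ is unit-regular if for every $x\in R$ there is a unit $u$ with $x=xux$. It is right morphic if $\mathrm{ann}_r(x)\cong R/xR$ as right modules for every $x\in R$, and left morphic if $\mathrm{ann}_l(x)\cong R/Rx$ as left modules for every $x\in R$. It is right quasi-morphic if for every $x\in R$ there are $y,z\in R$ with $xR=\mathrm{ann}_r(y)$ and $\mathrm{ann}_r(x)=zR$,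 and left quasi-morphic if for every $x\in R$ there are $y,z\in R$ with $Rx=\mathrm{ann}_l(y)$ and $\mathrm{ann}_l(x)=Rz$. *)

theory Defs
  imports "HOL-Algebra.QuotRing"
begin

text \<open>
  Carrier-based rings are used (rather than type classes) so that the zero ring is not
  excluded and so that corners \<open>p R p\<close> and cosets are available.
\<close>

record 'a star_ring = "'a ring" +
  star :: "'a \<Rightarrow> 'a"  ("_\<^sup>\<star>\<index>" [1000] 999)

locale star_ring = ring R for R :: "('a, 'm) star_ring_scheme" (structure) +
  assumes star_closed: "x \<in> carrier R \<Longrightarrow> x\<^sup>\<star> \<in> carrier R"
    and star_add: "\<lbrakk>x \<in> carrier R; y \<in> carrier R\<rbrakk> \<Longrightarrow> (x \<oplus> y)\<^sup>\<star> = x\<^sup>\<star> \<oplus> y\<^sup>\<star>"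
    and star_mult: "\<lbrakk>x \<in> carrier R; y \<in> carrier R\<rbrakk> \<Longrightarrow> (x \<otimes> y)\<^sup>\<star> = y\<^sup>\<star> \<otimes> x\<^sup>\<star>"
    and star_star: "x \<in> carrier R \<Longrightarrow> (x\<^sup>\<star>)\<^sup>\<star> = x"


section \<open>Annihilators, commutants, projections\<close>

text \<open>
  The library cosets \<open>x <#\<^bsub>R\<^esub> carrier R\<close> and \<open>carrier R #>\<^bsub>R\<^esub> x\<close>, taken with respect to the
  multiplication, are the principal one-sided ideals \<open>xR\<close> and \<open>Rx\<close>.
\<close>

definition ann_r :: "('a, 'm) ring_scheme \<Rightarrow> 'a set \<Rightarrow> 'a set" where
  "ann_r R S = {y \<in> carrier R. \<forall>x\<in>S. x \<otimes> y = \<zero>}" for R (structure)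

definition ann_l :: "('a, 'm) ring_scheme \<Rightarrow> 'a set \<Rightarrow> 'a set" where
  "ann_l R S = {y \<in> carrier R. \<forall>x\<in>S. y \<otimes> x = \<zero>}" for R (structure)

definition commutant :: "('a, 'm) ring_scheme \<Rightarrow> 'a set \<Rightarrow> 'a set" where
  "commutant R S = {y \<in> carrier R. \<forall>x\<in>S. x \<otimes> y = y \<otimes> x}" for R (structure)

definition projections :: "('a, 'm) star_ring_scheme \<Rightarrow> 'a set" where
  "projections R = {p \<in> carrier R. p\<^sup>\<star> = p \<and> p \<otimes> p = p}" for R (structure)

definition proj_order :: "('a, 'm) star_ring_scheme \<Rightarrow> 'a gorder" where
  "proj_order R = \<lparr>carrier = projections R, eq = (=), le = (\<lambda>p q. p = p \<otimes> q)\<rparr>"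
  for R (structure)

definition is_proj_sup :: "('a, 'm) star_ring_scheme \<Rightarrow> 'a \<Rightarrow> 'a set \<Rightarrow> bool" where
  "is_proj_sup R p P \<longleftrightarrow> least (proj_order R) p (Upper (proj_order R) P)"

definition unitaries :: "('a, 'm) star_ring_scheme \<Rightarrow> 'a set" where
  "unitaries R = {u \<in> carrier R. u\<^sup>\<star> \<otimes> u = \<one> \<and> u \<otimes> u\<^sup>\<star> = \<one>}" for R (structure)

definition partial_isometries :: "('a, 'm) star_ring_scheme \<Rightarrow> 'a set" where
  "partial_isometries R = {w \<in> carrier R. w \<otimes> w\<^sup>\<star> \<otimes> w = w}" for R (structure)

locale Baer_star_ring = star_ring +
  assumes ann_r_generated: "\<lbrakk>S \<subseteq> carrier R; S \<noteq> {}\<rbrakk> \<Longrightarrow>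
    \<exists>p \<in> projections R. ann_r R S = p <# carrier R"

definition RP :: "('a, 'm) star_ring_scheme \<Rightarrow> 'a \<Rightarrow> 'a" where
  "RP R x = (THE p. p \<in> projections R \<and> x \<otimes> p = x \<and>
     ann_r R {x} = (\<one> \<ominus> p) <# carrier R)" for R (structure)


section \<open>The axioms (A1)--(A6)\<close>

definition axiom_A1 :: "('a, 'm) star_ring_scheme \<Rightarrow> bool" where
  "axiom_A1 R \<longleftrightarrow> (\<forall>x \<in> carrier R. x\<^sup>\<star> \<otimes> x = \<one> \<longrightarrow> x \<otimes> x\<^sup>\<star> = \<one>)" for R (structure)

definition axiom_EP :: "('a, 'm) star_ring_scheme \<Rightarrow> bool" where
  "axiom_EP R \<longleftrightarrow> (\<forall>x \<in> carrier R. x \<noteq> \<zero> \<longrightarrow>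
     (\<exists>y \<in> commutant R (commutant R {x\<^sup>\<star> \<otimes> x}). y\<^sup>\<star> = y \<and>
        (x\<^sup>\<star> \<otimes> x) \<otimes> (y \<otimes> y) \<in> projections R \<and> (x\<^sup>\<star> \<otimes> x) \<otimes> (y \<otimes> y) \<noteq> \<zero>))"
  for R (structure)

definition star_positive :: "('a, 'm) star_ring_scheme \<Rightarrow> 'a \<Rightarrow> bool" where
  "star_positive R x \<longleftrightarrow> (\<exists>(m::nat) f. f \<in> {1..m} \<rightarrow> carrier R \<and>
     x = (\<Oplus>k\<in>{1..m}. (f k)\<^sup>\<star> \<otimes> f k))" for R (structure)

definition axiom_UPSR :: "('a, 'm) star_ring_scheme \<Rightarrow> bool" where
  "axiom_UPSR R \<longleftrightarrow> (\<forall>x. star_positive R x \<longrightarrow>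
     (\<exists>!y. y \<in> commutant R (commutant R {x\<^sup>\<star> \<otimes> x}) \<and> y \<otimes> y = x \<and> star_positive R y))"
  for R (structure)

definition axiom_A2 :: "('a, 'm) star_ring_scheme \<Rightarrow> bool" where
  "axiom_A2 R \<longleftrightarrow> axiom_EP R \<and> axiom_UPSR R"

text \<open>
  Families are represented by sets of partial isometries.  This loses no generality: if the
  initial projections of a family are pairwise orthogonal, no nonzero member occurs twice
  (such a \<open>w\<close> would satisfy \<open>w\<^sup>\<star>w = w\<^sup>\<star>w w\<^sup>\<star>w = 0\<close>, hence \<open>w = 0\<close>), and repeated zeros affect neither
  the suprema nor the remaining conditions.
\<close>

definition axiom_A3 :: "('a, 'm) star_ring_scheme \<Rightarrow> bool" where
  "axiom_A3 R \<longleftrightarrow> (\<forall>W. W \<subseteq> partial_isometries R \<longrightarrow>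
     pairwise (\<lambda>v w. (v\<^sup>\<star> \<otimes> v) \<otimes> (w\<^sup>\<star> \<otimes> w) = \<zero>) W \<longrightarrow>
     pairwise (\<lambda>v w. (v \<otimes> v\<^sup>\<star>) \<otimes> (w \<otimes> w\<^sup>\<star>) = \<zero>) W \<longrightarrow>
     (\<exists>w \<in> partial_isometries R.
        is_proj_sup R (w\<^sup>\<star> \<otimes> w) ((\<lambda>v. v\<^sup>\<star> \<otimes> v) ` W) \<and>
        is_proj_sup R (w \<otimes> w\<^sup>\<star>) ((\<lambda>v. v \<otimes> v\<^sup>\<star>) ` W) \<and>
        (\<forall>v\<in>W. w \<otimes> (v\<^sup>\<star> \<otimes> v) = v \<and> (v \<otimes> v\<^sup>\<star>) \<otimes> w = v)))" for R (structure)

definition axiom_A4 :: "('a, 'm) star_ring_scheme \<Rightarrow> bool" where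
  "axiom_A4 R \<longleftrightarrow> (\<forall>x \<in> carrier R. \<one> \<oplus> x\<^sup>\<star> \<otimes> x \<in> Units R)" for R (structure)

definition axiom_A5 :: "('a, 'm) star_ring_scheme \<Rightarrow> bool" where
  "axiom_A5 R \<longleftrightarrow> (\<exists>i \<in> commutant R (carrier R). i \<otimes> i = \<ominus> \<one> \<and> i\<^sup>\<star> = \<ominus> i)" for R (structure)

definition corner :: "('a, 'm) star_ring_scheme \<Rightarrow> 'a \<Rightarrow> ('a, 'm) star_ring_scheme" where
  "corner R p = R\<lparr>carrier := (\<lambda>x. p \<otimes> x \<otimes> p) ` carrier R, one := p\<rparr>" for R (structure)

definition axiom_A6 :: "('a, 'm) star_ring_scheme \<Rightarrow> bool" where
  "axiom_A6 R \<longleftrightarrow> (\<forall>u \<in> unitaries R. RP R (\<one> \<ominus> u) = \<one> \<longrightarrow>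
     (\<exists>p :: nat \<Rightarrow> 'a.
        (\<forall>n. p n \<in> projections R \<and> p n \<in> commutant R (commutant R {u})) \<and>
        (\<forall>n. p n \<sqsubseteq>\<^bsub>proj_order R\<^esub> p (Suc n)) \<and>
        is_proj_sup R \<one> (range p) \<and>
        (\<forall>n. (\<one> \<ominus> u) \<otimes> p n \<in> Units (corner R (p n)))))" for R :: "('a, 'm) star_ring_scheme" (structure)

definition axioms_A1_to_A6 :: "('a, 'm) star_ring_scheme \<Rightarrow> bool" where
  "axioms_A1_to_A6 R \<longleftrightarrow>
     axiom_A1 R \<and> axiom_A2 R \<and> axiom_A3 R \<and> axiom_A4 R \<and> axiom_A5 R \<and> axiom_A6 R"


section \<open>Regularity and the regular ring\<close>

definition von_Neumann_regular :: "('a, 'm) ring_scheme \<Rightarrow> bool" where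
  "von_Neumann_regular R \<longleftrightarrow> (\<forall>x \<in> carrier R. \<exists>y \<in> carrier R. x = x \<otimes> y \<otimes> x)"
  for R (structure)

definition unit_regular :: "('a, 'm) ring_scheme \<Rightarrow> bool" where
  "unit_regular R \<longleftrightarrow> (\<forall>x \<in> carrier R. \<exists>u \<in> Units R. x = x \<otimes> u \<otimes> x)" for R (structure)

definition star_ring_embedding ::
    "('a, 'm) star_ring_scheme \<Rightarrow> ('b, 'n) star_ring_scheme \<Rightarrow> ('a \<Rightarrow> 'b) \<Rightarrow> bool" where
  "star_ring_embedding R Q \<iota> \<longleftrightarrow> \<iota> \<in> ring_hom R Q \<and> inj_on \<iota> (carrier R) \<and>
     (\<forall>x \<in> carrier R. \<iota> (x\<^sup>\<star>\<^bsub>R\<^esub>) = (\<iota> x)\<^sup>\<star>\<^bsub>Q\<^esub>)"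

text \<open>
  \<open>regular_ring_of R Q \<iota>\<close>: the ring \<open>Q\<close>, into which \<open>R\<close> is embedded by \<open>\<iota>\<close>, is the regular ring
  of \<open>R\<close>.  If \<open>R\<close> literally is a subring of \<open>Q\<close>, then \<open>\<iota>\<close> is the identity.
\<close>

definition regular_ring_of ::
    "('a, 'm) star_ring_scheme \<Rightarrow> ('b, 'n) star_ring_scheme \<Rightarrow> ('a \<Rightarrow> 'b) \<Rightarrow> bool" where
  "regular_ring_of R Q \<iota> \<longleftrightarrow>
     Baer_star_ring Q \<and> axioms_A1_to_A6 Q \<and> von_Neumann_regular Q \<and>
     star_ring_embedding R Q \<iota> \<and>
     projections Q \<subseteq> \<iota> ` carrier R \<and>
     unitaries Q \<subseteq> \<iota> ` carrier R \<and>
     partial_isometries Q \<subseteq> \<iota> ` carrier R"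


section \<open>Morphic and quasi-morphic rings\<close>

text \<open>
  The library's modules are over commutative rings only.  Here a one-sided \<open>R\<close>-module is given by
  its additive group, written as a monoid record, together with the action of \<open>R\<close>.
\<close>

definition module_iso ::
    "('a, 'm) ring_scheme \<Rightarrow> ('b, 'k) monoid_scheme \<Rightarrow> ('a \<Rightarrow> 'b \<Rightarrow> 'b) \<Rightarrow>
     ('c, 'l) monoid_scheme \<Rightarrow> ('a \<Rightarrow> 'c \<Rightarrow> 'c) \<Rightarrow> bool" where
  "module_iso R M actM N actN \<longleftrightarrow>
     (\<exists>h \<in> iso M N. \<forall>r \<in> carrier R. \<forall>m \<in> carrier M. h (actM r m) = actN r (h m))"

text \<open>The induced right and left actions on the cosets of a right, respectively left, ideal \<open>I\<close>.\<close>

definition quot_act_r :: "('a, 'm) ring_scheme \<Rightarrow> 'a set \<Rightarrow> 'a \<Rightarrow> 'a set \<Rightarrow> 'a set" where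
  "quot_act_r R I r C = (\<Union>a\<in>C. I +> (a \<otimes> r))" for R (structure)

definition quot_act_l :: "('a, 'm) ring_scheme \<Rightarrow> 'a set \<Rightarrow> 'a \<Rightarrow> 'a set \<Rightarrow> 'a set" where
  "quot_act_l R I r C = (\<Union>a\<in>C. I +> (r \<otimes> a))" for R (structure)

definition right_morphic :: "('a, 'm) ring_scheme \<Rightarrow> bool" where
  "right_morphic R \<longleftrightarrow> (\<forall>x \<in> carrier R.
     module_iso R
       ((add_monoid R)\<lparr>carrier := ann_r R {x}\<rparr>) (\<lambda>r m. m \<otimes> r)
       (R A_Mod (x <# carrier R)) (quot_act_r R (x <# carrier R)))" for R (structure)

definition left_morphic :: "('a, 'm) ring_scheme \<Rightarrow> bool" where
  "left_morphic R \<longleftrightarrow> (\<forall>x \<in> carrier R.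
     module_iso R
       ((add_monoid R)\<lparr>carrier := ann_l R {x}\<rparr>) (\<lambda>r m. r \<otimes> m)
       (R A_Mod (carrier R #> x)) (quot_act_l R (carrier R #> x)))" for R (structure)

definition right_quasi_morphic :: "('a, 'm) ring_scheme \<Rightarrow> bool" where
  "right_quasi_morphic R \<longleftrightarrow> (\<forall>x \<in> carrier R. \<exists>y \<in> carrier R. \<exists>z \<in> carrier R.
     x <# carrier R = ann_r R {y} \<and> ann_r R {x} = z <# carrier R)" for R (structure)

definition left_quasi_morphic :: "('a, 'm) ring_scheme \<Rightarrow> bool" where
  "left_quasi_morphic R \<longleftrightarrow> (\<forall>x \<in> carrier R. \<exists>y \<in> carrier R. \<exists>z \<in> carrier R.
     carrier R #> x = ann_l R {y} \<and> ann_l R {x} = carrier R #> z)" for R (structure)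

end

theory Submission
  imports Defs "HOL-Algebra.Subrings"
begin

text \<open>
  All conditions are tied to von Neumann regularity of \<open>R\<close>.

  For any ring, unit-regular implies left and right morphic (if a unit \<open>u\<close> is an inner inverse of
  \<open>x\<close>, then \<open>u\<inverse>\<close> moves \<open>ann\<^sub>r(x)\<close> onto a complement of \<open>xR\<close>), and morphic implies quasi-morphic.
  A quasi-morphic Baer \<open>\<star>\<close>-ring is regular, because \<open>xR\<close>, being an annihilator, is generated by
  an idempotent.

  A regular ring \<open>R\<close> as in the theorem is unit-regular.  Regularity makes the positive
  square root of \<open>x\<^sup>\<star>x\<close> invertible in a corner, which gives a polar decomposition \<open>x = vr\<close>
  (\<open>polar_decomposition\<close>), and finiteness extends \<open>v\<close> to a unitary (\<open>unitary_extension\<close>), by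
  exhausting the complements of the initial and final projections of \<open>v\<close> with partial
  isometries and splitting off a central projection.

  Finally \<open>R = Q\<close> if and only if \<open>R\<close> is regular.  One direction is clear, as \<open>Q\<close> is regular.  For the
  other, \<open>R\<close> contains all unitaries of \<open>Q\<close>, in particular the Cayley transform of each self-adjoint
  \<open>r\<close>, and therefore \<open>(r + i)\<inverse>\<close>.  An element of \<open>R\<close> that is invertible in \<open>Q\<close> is invertible in \<open>R\<close>
  when \<open>R\<close> is regular, so \<open>r \<in> R\<close> (\<open>regular_subring_containing_unitaries_eq\<close>).
\<close>


section \<open>Unit-regular, morphic and quasi-morphic rings\<close>

lemma mem_l_coset: "y \<in> x <#\<^bsub>R\<^esub> A \<longleftrightarrow> (\<exists>a\<in>A. y = x \<otimes>\<^bsub>R\<^esub> a)"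
  by (auto simp: l_coset_def)

lemma mem_a_r_coset: "y \<in> I +>\<^bsub>R\<^esub> a \<longleftrightarrow> (\<exists>b\<in>I. y = b \<oplus>\<^bsub>R\<^esub> a)"
  by (auto simp: a_r_coset_def')

context ring
begin

lemma add_diff_cancel_carrier:
  assumes "x \<in> carrier R" "y \<in> carrier R"
  shows "x \<oplus> (y \<ominus> x) = y"
proof -
  have "x \<oplus> (y \<ominus> x) = (x \<oplus> \<ominus> x) \<oplus> y"
    unfolding minus_eq a_comm[OF assms(2) a_inv_closed[OF assms(1)]]
    using assms by (simp only: a_assoc a_inv_closed)
  then show ?thesis using assms by (simp add: r_neg)
qed

lemma Units_one_sidedI:
  assumes "l \<otimes> x = \<one>" "x \<otimes> r = \<one>" "x \<in> carrier R" "l \<in> carrier R" "r \<in> carrier R"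
  shows "x \<in> Units R"
  using assms inv_unique[of l x r] unfolding Units_def by blast

lemma add_cancel_middle:
  assumes "x \<in> carrier R" "y \<in> carrier R"
  shows "x \<oplus> (y \<oplus> \<ominus> x) = y"
    "z \<in> carrier R \<Longrightarrow> x \<oplus> (y \<oplus> (\<ominus> x \<oplus> z)) = y \<oplus> z"
  using assms by (simp_all add: a_lcomm[of x y] r_neg r_neg2)

lemma principal_right_ideal_additive:
  assumes "x \<in> carrier R"
  shows "abelian_subgroup (x <# carrier R) R"
proof (rule abelian_subgroupI3)
  show "additive_subgroup (x <# carrier R) R"
  proof (intro additive_subgroup.intro add.subgroupI)
    show "x <# carrier R \<subseteq> carrier R" "x <# carrier R \<noteq> {}"
      using assms by (auto simp: l_coset_def)
    fix a assume "a \<in> x <# carrier R"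
    then obtain r where r: "r \<in> carrier R" "a = x \<otimes> r" by (auto simp: mem_l_coset)
    then have "\<ominus> a = x \<otimes> (\<ominus> r)" using assms by (simp add: r_minus)
    then show "\<ominus> a \<in> x <# carrier R" using r by (auto simp: mem_l_coset)
    fix b assume "b \<in> x <# carrier R"
    then obtain s where s: "s \<in> carrier R" "b = x \<otimes> s" by (auto simp: mem_l_coset)
    have "a \<oplus> b = x \<otimes> (r \<oplus> s)" using r s assms by (simp add: r_distr)
    then show "a \<oplus> b \<in> x <# carrier R" using r s by (auto simp: mem_l_coset)
  qed
qed (fact is_abelian_group)

lemma quot_act_r_coset:
  assumes x: "x \<in> carrier R" and a: "a \<in> carrier R" and r: "r \<in> carrier R"
  shows "quot_act_r R (x <# carrier R) r ((x <# carrier R) +> a) = (x <# carrier R) +> (a \<otimes> r)"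
proof -
  interpret I: abelian_subgroup "x <# carrier R" R
    by (rule principal_right_ideal_additive[OF x])
  have "(x <# carrier R) +> (b \<otimes> r) = (x <# carrier R) +> (a \<otimes> r)"
    if "b \<in> (x <# carrier R) +> a" for b
  proof -
    from that obtain s where s: "s \<in> carrier R" "b = x \<otimes> s \<oplus> a"
      by (auto simp: mem_a_r_coset mem_l_coset)
    have "b \<otimes> r = x \<otimes> (s \<otimes> r) \<oplus> a \<otimes> r"
      using s x a r by (simp add: l_distr m_assoc)
    moreover have "x \<otimes> (s \<otimes> r) \<in> x <# carrier R"
      using s r by (auto simp: mem_l_coset)
    ultimately have "b \<otimes> r \<in> (x <# carrier R) +> (a \<otimes> r)"
      unfolding mem_a_r_coset by blast
    from a_repr_independence[OF this _ I.a_subgroup] show ?thesis using a r by simp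
  qed
  moreover have "a \<in> (x <# carrier R) +> a" using a by (simp add: I.a_rcos_self)
  ultimately show ?thesis unfolding quot_act_r_def by blast
qed

text \<open>
  If \<open>x = xux\<close> with \<open>u\<close> a unit, then \<open>ann\<^sub>r(x) = (1 - ux)R\<close>, and \<open>(1 - xu)R\<close> is a complement of
  \<open>xR\<close>.  Since \<open>u\<inverse>(1 - ux) = (1 - xu)u\<inverse>\<close>, left multiplication by \<open>u\<inverse>\<close> carries the former onto the
  latter, so the required isomorphism is \<open>m \<mapsto> xR + u\<inverse>m\<close>.
\<close>

lemma unit_regular_imp_right_morphic:
  assumes "unit_regular R"
  shows "right_morphic R"
  unfolding right_morphic_def module_iso_def
proof
  fix x assume x: "x \<in> carrier R"
  from assms x obtain u where u: "u \<in> Units R" and xux: "x = x \<otimes> u \<otimes> x"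
    unfolding unit_regular_def by blast
  define v where "v = inv u"
  have uv: "u \<in> carrier R" "v \<in> carrier R" "u \<otimes> v = \<one>" "v \<otimes> u = \<one>"
    using u by (auto simp: v_def)
  let ?I = "x <# carrier R"
  interpret I: abelian_subgroup ?I R by (rule principal_right_ideal_additive[OF x])
  define h where "h m = ?I +> (v \<otimes> m)" for m
  have annD: "m \<in> carrier R" "x \<otimes> m = \<zero>" if "m \<in> ann_r R {x}" for m
    using that by (auto simp: ann_r_def)
  have sub: "m \<ominus> n \<in> ann_r R {x}" if "m \<in> ann_r R {x}" "n \<in> ann_r R {x}" for m n
    using annD[OF that(1)] annD[OF that(2)] x by (simp add: ann_r_def minus_eq r_distr r_minus)
  have xuxr: "x \<otimes> (u \<otimes> (x \<otimes> r)) = x \<otimes> r" if "r \<in> carrier R" for r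
    using that xux x uv by (metis m_assoc m_closed)
  have kernel_trivial: "m = \<zero>" if m: "m \<in> ann_r R {x}" and vm: "v \<otimes> m \<in> ?I" for m
  proof -
    from vm obtain r where r: "r \<in> carrier R" "v \<otimes> m = x \<otimes> r" by (auto simp: mem_l_coset)
    then have m_eq: "m = u \<otimes> (x \<otimes> r)" using uv annD[OF m] x by (metis l_one m_assoc)
    then have "x \<otimes> r = \<zero>" using annD[OF m] xuxr[OF r(1)] by simp
    then show ?thesis using m_eq uv by simp
  qed
  have inj: "inj_on h (ann_r R {x})"
  proof (rule inj_onI)
    fix m n assume mn: "m \<in> ann_r R {x}" "n \<in> ann_r R {x}" "h m = h n"
    then have "v \<otimes> m \<ominus> v \<otimes> n \<in> ?I"
      using annD uv I.a_rcos_self[of "v \<otimes> m"]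
      by (simp add: h_def flip: I.a_rcos_module_minus[OF ring_axioms])
    moreover have "v \<otimes> m \<ominus> v \<otimes> n = v \<otimes> (m \<ominus> n)"
      using annD[OF mn(1)] annD[OF mn(2)] uv by (simp add: minus_eq r_distr r_minus)
    ultimately have "m \<ominus> n = \<zero>" using kernel_trivial sub mn by simp
    then show "m = n" using annD mn by (simp add: r_right_minus_eq)
  qed
  have surj: "h ` ann_r R {x} = carrier (R A_Mod ?I)"
  proof -
    have "\<exists>m\<in>ann_r R {x}. ?I +> a = h m" if a: "a \<in> carrier R" for a
    proof
      \<comment> \<open>\<open>u\<close> times the component of \<open>a\<close> in the complement \<open>(1 - xu)R\<close> of \<open>xR\<close>\<close>
      define m where "m = u \<otimes> (a \<ominus> x \<otimes> (u \<otimes> a))"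
      have "x \<otimes> m = x \<otimes> (u \<otimes> a) \<ominus> x \<otimes> (u \<otimes> (x \<otimes> (u \<otimes> a)))"
        using a x uv by (simp add: m_def minus_eq r_distr r_minus)
      also have "\<dots> = \<zero>" using a x uv by (simp add: xuxr r_right_minus_eq)
      finally show "m \<in> ann_r R {x}" using a x uv by (simp add: m_def ann_r_def)
      have "v \<otimes> m = a \<ominus> x \<otimes> (u \<otimes> a)"
        using a x uv by (simp add: m_def flip: m_assoc)
      then have "x \<otimes> (u \<otimes> a) \<oplus> v \<otimes> m = a"
        using add_diff_cancel_carrier[of "x \<otimes> (u \<otimes> a)" a] a x uv by simp
      moreover have "x \<otimes> (u \<otimes> a) \<in> ?I"
        using a uv unfolding mem_l_coset by (intro bexI[of _ "u \<otimes> a"]) simp_all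
      then have "x \<otimes> (u \<otimes> a) \<oplus> v \<otimes> m \<in> ?I +> (v \<otimes> m)"
        unfolding mem_a_r_coset by blast
      ultimately have "a \<in> ?I +> (v \<otimes> m)" by (rule subst)
      moreover have "v \<otimes> m \<in> carrier R" using a x uv by (simp add: m_def)
      ultimately show "?I +> a = h m"
        unfolding h_def by (intro sym[OF a_repr_independence[OF _ _ I.a_subgroup]])
    qed
    moreover have "h m \<in> carrier (R A_Mod ?I)" if "m \<in> ann_r R {x}" for m
      using annD[OF that] uv by (auto simp: A_FactGroup_def' A_RCOSETS_def' h_def)
    ultimately show ?thesis
      unfolding A_FactGroup_def' A_RCOSETS_def' by (auto simp: image_iff)
  qed
  have hom: "h \<in> hom ((add_monoid R)\<lparr>carrier := ann_r R {x}\<rparr>) (R A_Mod ?I)"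
  proof (rule homI)
    fix m n assume "m \<in> carrier ((add_monoid R)\<lparr>carrier := ann_r R {x}\<rparr>)"
      "n \<in> carrier ((add_monoid R)\<lparr>carrier := ann_r R {x}\<rparr>)"
    then have mn: "m \<in> carrier R" "n \<in> carrier R" using annD by auto
    then show "h (m \<otimes>\<^bsub>(add_monoid R)\<lparr>carrier := ann_r R {x}\<rparr>\<^esub> n) = h m \<otimes>\<^bsub>R A_Mod ?I\<^esub> h n"
      using uv by (simp add: h_def A_FactGroup_def' I.a_rcos_sum r_distr)
  qed (use surj in auto)
  have "h (m \<otimes> r) = quot_act_r R ?I r (h m)" if "r \<in> carrier R" "m \<in> ann_r R {x}" for r m
    using that annD[of m] x uv by (simp add: h_def quot_act_r_coset m_assoc)
  then show "\<exists>h\<in>iso ((add_monoid R)\<lparr>carrier := ann_r R {x}\<rparr>) (R A_Mod ?I).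
      \<forall>r\<in>carrier R. \<forall>m\<in>carrier ((add_monoid R)\<lparr>carrier := ann_r R {x}\<rparr>).
        h (m \<otimes> r) = quot_act_r R ?I r (h m)"
    using inj surj hom by (intro bexI[of _ h]) (auto simp: iso_def bij_betw_def)
qed

text \<open>
  An isomorphism \<open>ann\<^sub>r(x) \<cong> R/xR\<close> is determined by the preimage \<open>y\<close> of the coset of \<open>1\<close>.  As that
  coset generates \<open>R/xR\<close> and has annihilator \<open>xR\<close>, the element \<open>y\<close> generates \<open>ann\<^sub>r(x)\<close> and
  \<open>ann\<^sub>r(y) = xR\<close>; so the single element \<open>y\<close> serves for both halves of quasi-morphicity.
\<close>

lemma right_morphic_imp_right_quasi_morphic:
  assumes "right_morphic R"
  shows "right_quasi_morphic R"
  unfolding right_quasi_morphic_def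
proof
  fix x assume x: "x \<in> carrier R"
  let ?I = "x <# carrier R" and ?A = "(add_monoid R)\<lparr>carrier := ann_r R {x}\<rparr>"
  interpret I: abelian_subgroup ?I R by (rule principal_right_ideal_additive[OF x])
  from assms x obtain h where iso: "h \<in> iso ?A (R A_Mod ?I)"
    and "\<forall>r\<in>carrier R. \<forall>m\<in>carrier ?A. h (m \<otimes> r) = quot_act_r R ?I r (h m)"
    unfolding right_morphic_def module_iso_def by blast
  then have act: "h (m \<otimes> r) = quot_act_r R ?I r (h m)"
    if "r \<in> carrier R" "m \<in> ann_r R {x}" for r m
    using that by simp
  have bij: "bij_betw h (ann_r R {x}) (carrier (R A_Mod ?I))"
    using iso by (simp add: iso_def)
  have "?I +> \<one> \<in> carrier (R A_Mod ?I)"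
    by (auto simp: A_FactGroup_def' A_RCOSETS_def')
  then have "?I +> \<one> \<in> h ` ann_r R {x}"
    using bij_betw_imp_surj_on[OF bij] by simp
  then obtain y where y: "y \<in> ann_r R {x}" "h y = ?I +> \<one>"
    by (metis imageE)
  have yR: "y \<in> carrier R" "x \<otimes> y = \<zero>" using y by (auto simp: ann_r_def)
  have hyr: "h (y \<otimes> r) = ?I +> r" if "r \<in> carrier R" for r
    using act[OF that y(1)] y(2) that x by (simp add: quot_act_r_coset)
  have yr: "y \<otimes> r \<in> ann_r R {x}" if "r \<in> carrier R" for r
    using that yR x by (simp add: ann_r_def flip: m_assoc)
  have zero: "\<zero> \<in> ann_r R {x}" using x by (simp add: ann_r_def)
  have h0: "h \<zero> = ?I"
    using hyr[of \<zero>] yR by (simp add: I.a_rcos_const)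
  have ann_x: "ann_r R {x} = y <# carrier R"
  proof (intro equalityI subsetI)
    fix m assume m: "m \<in> ann_r R {x}"
    then have "h m \<in> carrier (R A_Mod ?I)" using bij by (auto simp: bij_betw_def)
    then obtain r where r: "r \<in> carrier R" "h m = ?I +> r"
      by (auto simp: A_FactGroup_def' A_RCOSETS_def')
    then have "h m = h (y \<otimes> r)" using hyr by simp
    then have "m = y \<otimes> r" using bij m yr[OF r(1)] by (auto simp: bij_betw_def inj_on_def)
    then show "m \<in> y <# carrier R" using r by (auto simp: mem_l_coset)
  qed (auto simp: mem_l_coset yr)
  have ann_y: "?I = ann_r R {y}"
  proof -
    have "r \<in> ?I \<longleftrightarrow> y \<otimes> r = \<zero>" if r: "r \<in> carrier R" for r
    proof -
      have "y \<otimes> r = \<zero> \<longleftrightarrow> h (y \<otimes> r) = h \<zero>"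
        using bij yr[OF r] zero by (auto simp: bij_betw_def inj_on_def)
      also have "\<dots> \<longleftrightarrow> r \<in> ?I"
        using hyr[OF r] h0 r I.a_rcos_const I.a_rcos_self[of r] by auto
      finally show ?thesis by blast
    qed
    then show ?thesis using I.a_subset by (auto simp: ann_r_def)
  qed
  show "\<exists>y\<in>carrier R. \<exists>z\<in>carrier R. ?I = ann_r R {y} \<and> ann_r R {x} = z <# carrier R"
    using ann_x ann_y yR by blast
qed

end


section \<open>Passing from right to left\<close>

definition opposite_ring :: "('a, 'm) ring_scheme \<Rightarrow> ('a, 'm) ring_scheme" where
  "opposite_ring R = R\<lparr>mult := \<lambda>x y. y \<otimes>\<^bsub>R\<^esub> x\<rparr>"

lemma opposite_ring_simps [simp]:
  "carrier (opposite_ring R) = carrier R"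
  "\<one>\<^bsub>opposite_ring R\<^esub> = \<one>\<^bsub>R\<^esub>" "\<zero>\<^bsub>opposite_ring R\<^esub> = \<zero>\<^bsub>R\<^esub>"
  "add (opposite_ring R) = add R"
  "x \<otimes>\<^bsub>opposite_ring R\<^esub> y = y \<otimes>\<^bsub>R\<^esub> x"
  by (simp_all add: opposite_ring_def)

lemma opposite_ring_notions [simp]:
  "ann_r (opposite_ring R) S = ann_l R S"
  "x <#\<^bsub>opposite_ring R\<^esub> A = A #>\<^bsub>R\<^esub> x"
  "A_FactGroup (opposite_ring R) I = A_FactGroup R I"
  "quot_act_r (opposite_ring R) I = quot_act_l R I"
  "Units (opposite_ring R) = Units R"
  by (auto simp: ann_r_def ann_l_def l_coset_def r_coset_def A_FactGroup_def
      quot_act_r_def quot_act_l_def a_r_coset_def Units_def fun_eq_iff)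

lemma (in ring) ring_opposite_ring: "ring (opposite_ring R)"
proof (rule ring.intro)
  show "abelian_group (opposite_ring R)"
    using is_abelian_group
    by (simp add: abelian_group_def abelian_monoid_def abelian_group_axioms_def)
  show "Group.monoid (opposite_ring R)"
    by (rule monoidI) (simp_all add: m_assoc)
  show "ring_axioms (opposite_ring R)"
    by unfold_locales (simp_all add: l_distr r_distr)
qed

text \<open>
  The opposite ring has the same additive group and exchanges left and right multiplication, so
  a statement about left ideals of \<open>R\<close> is the corresponding one about right ideals of its opposite.
\<close>

lemma right_morphic_opposite_ring: "right_morphic (opposite_ring R) \<longleftrightarrow> left_morphic R"
  by (simp add: right_morphic_def left_morphic_def module_iso_def)

lemma right_quasi_morphic_opposite_ring:
  "right_quasi_morphic (opposite_ring R) \<longleftrightarrow> left_quasi_morphic R"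
  by (simp add: right_quasi_morphic_def left_quasi_morphic_def)

lemma (in ring) unit_regular_imp_left_morphic:
  assumes "unit_regular R"
  shows "left_morphic R"
proof -
  have "unit_regular (opposite_ring R)"
    using assms unfolding unit_regular_def
    by (auto simp: m_assoc Units_closed)
  then show ?thesis
    using ring.unit_regular_imp_right_morphic[OF ring_opposite_ring]
    by (simp add: right_morphic_opposite_ring)
qed

lemma (in ring) left_morphic_imp_left_quasi_morphic:
  assumes "left_morphic R"
  shows "left_quasi_morphic R"
  using ring.right_morphic_imp_right_quasi_morphic[OF ring_opposite_ring] assms
  by (simp add: right_morphic_opposite_ring right_quasi_morphic_opposite_ring)


section \<open>Rings with involution\<close>

context star_ring
begin

lemma star_zero [simp]: "\<zero>\<^sup>\<star> = \<zero>"
proof -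
  have "\<zero>\<^sup>\<star> \<oplus> \<zero>\<^sup>\<star> = \<zero>\<^sup>\<star>" using star_add[of \<zero> \<zero>] by simp
  then show ?thesis using star_closed[OF zero_closed] by (simp add: add.r_cancel_one)
qed

lemma star_one [simp]: "\<one>\<^sup>\<star> = \<one>"
  using star_mult[of "\<one>\<^sup>\<star>" \<one>] star_star[of \<one>] star_closed[of \<one>] by simp

lemma star_minus: "x \<in> carrier R \<Longrightarrow> (\<ominus> x)\<^sup>\<star> = \<ominus> (x\<^sup>\<star>)"
  using star_add[of "\<ominus> x" x] star_closed[of x] star_closed[of "\<ominus> x"]
  by (simp add: l_neg minus_equality)

lemma star_diff: "x \<in> carrier R \<Longrightarrow> y \<in> carrier R \<Longrightarrow> (x \<ominus> y)\<^sup>\<star> = x\<^sup>\<star> \<ominus> y\<^sup>\<star>"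
  by (simp add: minus_eq star_add star_minus)

lemmas star_simps = star_closed star_star star_mult star_add star_minus star_diff

lemma star_inj: "x \<in> carrier R \<Longrightarrow> y \<in> carrier R \<Longrightarrow> x\<^sup>\<star> = y\<^sup>\<star> \<Longrightarrow> x = y"
  by (metis star_star)

lemma star_sum_of_squares:
  assumes "finite A" "f \<in> A \<rightarrow> carrier R"
  shows "(\<Oplus>k\<in>A. (f k)\<^sup>\<star> \<otimes> f k) \<in> carrier R
    \<and> (\<Oplus>k\<in>A. (f k)\<^sup>\<star> \<otimes> f k)\<^sup>\<star> = (\<Oplus>k\<in>A. (f k)\<^sup>\<star> \<otimes> f k)"
  using assms
proof (induction A)
  case (insert a A)
  then have f: "f a \<in> carrier R" "(\<lambda>k. (f k)\<^sup>\<star> \<otimes> f k) \<in> A \<rightarrow> carrier R"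
    by (auto simp: star_closed Pi_iff)
  with insert show ?case
    by (simp add: finsum_insert star_closed star_add star_mult star_star)
qed simp

lemma star_positive_self_adjoint:
  assumes "star_positive R x"
  shows "x \<in> carrier R" "x\<^sup>\<star> = x"
  using assms star_sum_of_squares[OF finite_atLeastAtMost] unfolding star_positive_def by auto

lemma star_positive_square:
  assumes "x \<in> carrier R"
  shows "star_positive R (x\<^sup>\<star> \<otimes> x)"
  unfolding star_positive_def
  using assms by (intro exI[of _ "1::nat"] exI[of _ "\<lambda>_. x"]) (simp add: star_closed)

lemma projectionD:
  assumes "p \<in> projections R"
  shows "p \<in> carrier R" "p\<^sup>\<star> = p" "p \<otimes> p = p"
  using assms by (auto simp: projections_def)

lemma projection_complement:
  assumes "p \<in> projections R"
  shows "\<one> \<ominus> p \<in> projections R"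
  using projectionD[OF assms]
  by (simp add: projections_def star_add star_minus minus_eq l_distr r_distr l_minus
      r_minus a_assoc l_neg r_neg)

lemma projections_orthogonal_commute:
  assumes "p \<in> projections R" "q \<in> projections R" "p \<otimes> q = \<zero>"
  shows "q \<otimes> p = \<zero>"
  using star_mult[of p q] projectionD[OF assms(1)] projectionD[OF assms(2)] assms(3) by simp

end

lemma (in star_ring) is_proj_supD:
  assumes sup: "is_proj_sup R p P" and P: "P \<subseteq> projections R"
  shows "p \<in> projections R" "q \<in> P \<Longrightarrow> q \<otimes> p = q"
    "q \<in> projections R \<Longrightarrow> (\<And>x. x \<in> P \<Longrightarrow> x \<otimes> q = x) \<Longrightarrow> p \<otimes> q = p"
  using assms unfolding is_proj_sup_def least_def Upper_def proj_order_def
  by (auto simp: eq_commute[of _ "_ \<otimes> _"])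

lemma (in star_ring) proj_sup_orthogonal:
  assumes sup: "is_proj_sup R p P" and P: "P \<subseteq> projections R" and q: "q \<in> projections R"
    and orth: "\<And>x. x \<in> P \<Longrightarrow> x \<otimes> q = \<zero>"
  shows "p \<otimes> q = \<zero>"
proof -
  note qD = projectionD[OF q] and pD = projectionD[OF is_proj_supD(1)[OF sup P]]
  have "x \<otimes> (\<one> \<ominus> q) = x" if "x \<in> P" for x
    using that orth projectionD(1) P qD(1) by (auto simp: minus_eq r_distr r_minus)
  then have "p \<otimes> (\<one> \<ominus> q) = p"
    using is_proj_supD(3)[OF sup P] projection_complement[OF q] by blast
  then have "p \<otimes> (\<one> \<ominus> q) \<otimes> q = p \<otimes> q" by simp
  moreover have "(\<one> \<ominus> q) \<otimes> q = \<zero>" using qD by (simp add: minus_eq l_distr l_minus r_neg)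
  ultimately show ?thesis using pD(1) qD(1) by (simp add: m_assoc)
qed

lemma (in star_ring) orthogonal_projections_sum:
  assumes p: "p \<in> projections R" and q: "q \<in> projections R" and orth: "p \<otimes> q = \<zero>"
  shows "p \<oplus> q \<in> projections R"
  using projectionD[OF p] projectionD[OF q] orth projections_orthogonal_commute[OF p q orth]
  by (simp add: projections_def star_add l_distr r_distr)


section \<open>The Cayley transform\<close>

context star_ring
begin

text \<open>
  A self-adjoint \<open>r\<close> is recovered from its Cayley transform \<open>u = (r - i)(r + i)\<inverse>\<close>, which is unitary,
  through \<open>1 - u = 2i(r + i)\<inverse>\<close>.  A subring \<open>A\<close> containing the unitaries thus contains \<open>(r + i)\<inverse>\<close>
  up to the factor \<open>2i\<close>; regularity of \<open>A\<close> allows the inversion inside \<open>A\<close>, because \<open>a = aba\<close> forces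
  \<open>b = a\<inverse>\<close> when \<open>a\<close> is invertible in \<open>R\<close>.  Hence \<open>A\<close> contains every self-adjoint element, and every
  element of \<open>R\<close> is a combination of two of these.  Axiom (A4) makes \<open>2 = 1 + 1\<^sup>\<star>1\<close>
  and \<open>(r + i)(r - i) = 1 + r\<^sup>\<star>r\<close> invertible.
\<close>

lemma regular_subring_containing_unitaries_eq:
  assumes A4: "axiom_A4 R" and A5: "axiom_A5 R"
    and sub: "subring A R" and unitaries: "unitaries R \<subseteq> A"
    and reg: "\<And>a. a \<in> A \<Longrightarrow> \<exists>b\<in>A. a = a \<otimes> b \<otimes> a"
  shows "A = carrier R"
proof
  note sA = subringE[OF sub]
  show AR: "A \<subseteq> carrier R" by (rule sA(1))
  have inv_A: "inv a \<in> A" if "a \<in> A" "a \<in> Units R" for a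
  proof -
    obtain b where b: "b \<in> A" "a = a \<otimes> b \<otimes> a" using reg \<open>a \<in> A\<close> by blast
    have ab: "a \<in> carrier R" "b \<in> carrier R" using that b AR by auto
    have "a \<otimes> \<one> = a \<otimes> (b \<otimes> a)" using b(2) ab by (simp flip: m_assoc)
    then have "b \<otimes> a = \<one>" using that ab Units_l_cancel by (metis one_closed m_closed)
    then have "inv a = b" using that ab by (metis Units_inv_closed Units_r_inv l_one m_assoc r_one)
    then show ?thesis using b by simp
  qed
  obtain i where i: "i \<in> carrier R" "\<And>x. x \<in> carrier R \<Longrightarrow> x \<otimes> i = i \<otimes> x"
      "i \<otimes> i = \<ominus> \<one>" "i\<^sup>\<star> = \<ominus> i"
    using A5 unfolding axiom_A5_def commutant_def by blast
  have "(\<ominus> i) \<otimes> i = \<one>" "i \<otimes> (\<ominus> i) = \<one>"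
    using i(1,3) by (simp_all add: l_minus r_minus)
  then have i_unit: "i \<in> Units R"
    using i(1) a_inv_closed[OF i(1)] unfolding Units_def by blast
  have iA: "i \<in> A"
    using unitaries i(1,3,4) by (auto simp: unitaries_def l_minus r_minus)
  define two where "two = \<one> \<oplus> \<one>"
  have two: "two \<in> carrier R" "two \<in> A" "two \<in> Units R"
    using A4 sA(3) sA(7) unfolding two_def axiom_A4_def by (auto dest: bspec[of _ _ \<one>])
  have self_adjoint: "r \<in> A" if r: "r \<in> carrier R" "r\<^sup>\<star> = r" for r
  proof -
    define s where "s = r \<oplus> i"
    define m where "m = r \<ominus> i"
    have sm: "s \<in> carrier R" "m \<in> carrier R" "s\<^sup>\<star> = m" "m\<^sup>\<star> = s"
      using r i(1,4) by (auto simp: s_def m_def star_simps minus_eq)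
    define n where "n = \<one> \<oplus> r\<^sup>\<star> \<otimes> r"
    have n: "n \<in> Units R" using A4 r unfolding n_def axiom_A4_def by blast
    have prod: "s \<otimes> m = n" "m \<otimes> s = n"
      using r i(1,3) i(2)[OF r(1)]
      by (simp_all add: s_def m_def n_def minus_eq minus_add l_distr r_distr l_minus r_minus
          a_ac r_neg r_neg2 r_neg1 add_cancel_middle)
    have units: "s \<in> Units R" "m \<in> Units R"
    proof -
      have "s \<otimes> (m \<otimes> inv n) = \<one>" "(inv n \<otimes> m) \<otimes> s = \<one>"
        "m \<otimes> (s \<otimes> inv n) = \<one>" "(inv n \<otimes> s) \<otimes> m = \<one>"
        using prod sm n by (simp_all add: m_assoc) (simp_all add: prod flip: m_assoc)
      then show "s \<in> Units R" "m \<in> Units R"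
        using sm n by (auto intro: Units_one_sidedI)
    qed
    define j where "j = inv s"
    define k where "k = inv m"
    have jk: "j \<in> carrier R" "k \<in> carrier R" "s \<otimes> j = \<one>" "j \<otimes> s = \<one>" "m \<otimes> k = \<one>" "k \<otimes> m = \<one>"
      using units by (auto simp: j_def k_def)
    have j_star: "j\<^sup>\<star> = k"
    proof -
      have "j\<^sup>\<star> \<otimes> m = \<one>" using star_mult[of s j] sm jk by simp
      then show ?thesis using jk sm by (metis star_closed inv_unique)
    qed
    have kj: "k \<otimes> j = j \<otimes> k"
    proof -
      have "n \<otimes> (k \<otimes> j) = s \<otimes> (m \<otimes> k) \<otimes> j" "n \<otimes> (j \<otimes> k) = m \<otimes> (s \<otimes> j) \<otimes> k"
        using sm jk(1,2) by (simp_all add: m_assoc flip: prod)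
          (simp_all add: prod flip: prod(1) m_assoc)
      then show ?thesis using sm jk n Units_l_cancel[of n "k \<otimes> j" "j \<otimes> k"] by simp
    qed
    \<comment> \<open>the Cayley transform of \<open>r\<close>\<close>
    define u where "u = m \<otimes> j"
    have u: "u \<in> carrier R" "u\<^sup>\<star> = k \<otimes> s"
      using sm jk by (auto simp: u_def star_mult j_star)
    have "s \<otimes> (m \<otimes> j) = m" "j \<otimes> (k \<otimes> s) = k"
      using sm jk prod kj by (metis m_assoc r_one)+
    then have "u\<^sup>\<star> \<otimes> u = \<one>" "u \<otimes> u\<^sup>\<star> = \<one>"
      using sm jk unfolding u by (simp_all add: u_def m_assoc)
    then have "u \<in> unitaries R" using u(1) by (simp add: unitaries_def)
    then have uA: "u \<in> A" using unitaries by blast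
    define t where "t = two \<otimes> i"
    have t: "t \<in> A" "t \<in> Units R" "t \<in> carrier R"
      using two iA i_unit sA by (auto simp: t_def)
    \<comment> \<open>\<open>(r + i) - (r - i) = 2i\<close>, so \<open>1 - u = 2i(r + i)\<inverse>\<close>\<close>
    have "s \<ominus> m = t"
      using r i(1) by (simp add: s_def m_def t_def two_def minus_eq minus_add l_distr a_ac
          r_neg r_neg1 r_neg2)
    then have "t \<otimes> j = \<one> \<ominus> u"
      using sm jk by (auto simp: u_def minus_eq l_distr l_minus)
    then have "t \<otimes> j \<in> A" using uA sA by (simp add: minus_eq)
    moreover have j_unit: "j \<in> Units R" using units by (simp add: j_def)
    ultimately have "inv (t \<otimes> j) \<in> A" using inv_A t by simp
    then have "inv (t \<otimes> j) \<otimes> t \<in> A" using t sA by simp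
    moreover have "inv (t \<otimes> j) \<otimes> t = s"
    proof -
      have "(t \<otimes> j) \<otimes> (s \<otimes> inv t) = t \<otimes> (j \<otimes> s) \<otimes> inv t"
        using t jk(1) sm by (simp add: m_assoc)
      also have "\<dots> = \<one>" using t jk by simp
      finally have "inv (t \<otimes> j) = s \<otimes> inv t"
        using t jk(1) sm j_unit inv_unique[of "inv (t \<otimes> j)" "t \<otimes> j" "s \<otimes> inv t"] by simp
      then show ?thesis using t sm by (simp add: m_assoc)
    qed
    ultimately have "s \<ominus> i \<in> A" using iA sA by (simp add: minus_eq)
    then show "r \<in> A" using r i(1) by (simp add: s_def minus_eq a_assoc r_neg)
  qed
  show "carrier R \<subseteq> A"
  proof
    fix q assume q: "q \<in> carrier R"
    \<comment> \<open>the real and imaginary parts of \<open>q\<close> up to factors: \<open>2q = a - ib\<close>\<close>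
    define a where "a = q \<oplus> q\<^sup>\<star>"
    define b where "b = i \<otimes> (q \<ominus> q\<^sup>\<star>)"
    have qs: "q\<^sup>\<star> \<in> carrier R" using q by (rule star_closed)
    have aA: "a \<in> A"
      using q qs by (intro self_adjoint) (auto simp: a_def star_simps a_comm)
    have bA: "b \<in> A"
    proof (intro self_adjoint)
      show "b\<^sup>\<star> = b"
        using q qs i(1,4) i(2)[OF q] i(2)[OF qs]
        by (simp add: b_def star_simps minus_eq l_distr r_distr l_minus r_minus a_comm)
    qed (use q qs i(1) in \<open>simp add: b_def\<close>)
    have "i \<otimes> b = \<ominus> (q \<ominus> q\<^sup>\<star>)"
      using q qs i(1,3) by (simp add: b_def l_minus flip: m_assoc)
    then have "two \<otimes> q = a \<ominus> i \<otimes> b"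
      using q qs by (simp add: a_def two_def l_distr minus_eq minus_add a_ac r_neg r_neg1 r_neg2)
    then have "two \<otimes> q \<in> A" using aA bA iA sA by (simp add: minus_eq)
    then have "inv two \<otimes> (two \<otimes> q) \<in> A" using two inv_A sA by simp
    then show "q \<in> A" using q two by (simp flip: m_assoc)
  qed
qed

end


section \<open>Quasi-morphic Baer rings\<close>

context Baer_star_ring
begin

text \<open>
  The projection \<open>p\<close> generating \<open>ann\<^sub>r(x\<^sup>\<star>)\<close> kills \<open>x\<close>, because \<open>p\<close> lies in that annihilator and is
  self-adjoint.  When \<open>x\<^sup>\<star>x = 0\<close>, also \<open>x\<close> lies in it, so that \<open>p\<close> fixes \<open>x\<close>.
\<close>

lemma proper_involution:
  assumes x: "x \<in> carrier R" and "x\<^sup>\<star> \<otimes> x = \<zero>"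
  shows "x = \<zero>"
proof -
  obtain p where p: "p \<in> projections R" and ann: "ann_r R {x\<^sup>\<star>} = p <# carrier R"
    using ann_r_generated[of "{x\<^sup>\<star>}"] star_closed[OF x] by auto
  note pD = projectionD[OF p]
  have "p \<in> ann_r R {x\<^sup>\<star>}" unfolding ann mem_l_coset using pD by force
  then have "x\<^sup>\<star> \<otimes> p = \<zero>" by (simp add: ann_r_def)
  then have "p \<otimes> x = \<zero>" using star_mult[OF star_closed[OF x] pD(1)] pD x by (simp add: star_star)
  moreover have "x \<in> p <# carrier R" using assms by (simp flip: ann add: ann_r_def)
  then have "p \<otimes> x = x" using pD by (auto simp: mem_l_coset simp flip: m_assoc)
  ultimately show ?thesis by simp
qed

lemma square_mult_zero_iff:
  assumes "x \<in> carrier R" "y \<in> carrier R"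
  shows "(x\<^sup>\<star> \<otimes> x) \<otimes> y = \<zero> \<longleftrightarrow> x \<otimes> y = \<zero>"
proof
  assume "(x\<^sup>\<star> \<otimes> x) \<otimes> y = \<zero>"
  then have "y\<^sup>\<star> \<otimes> ((x\<^sup>\<star> \<otimes> x) \<otimes> y) = \<zero>" using assms by (simp add: star_closed)
  then have "(x \<otimes> y)\<^sup>\<star> \<otimes> (x \<otimes> y) = \<zero>" using assms by (simp add: star_simps m_assoc)
  then show "x \<otimes> y = \<zero>" using assms by (simp add: proper_involution)
qed (use assms in \<open>simp add: star_closed m_assoc\<close>)

lemma right_projection_exists:
  assumes x: "x \<in> carrier R"
  obtains p where "p \<in> projections R" "ann_r R {x} = p <# carrier R"
  using ann_r_generated[of "{x}"] x by auto

lemma generated_by_projection_iff: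
  assumes "p \<in> projections R" "y \<in> carrier R"
  shows "y \<in> p <# carrier R \<longleftrightarrow> p \<otimes> y = y"
  using assms projectionD[OF assms(1)] by (force simp: mem_l_coset simp flip: m_assoc)

text \<open>
  In a quasi-morphic ring principal right ideals are annihilators, and in a Baer ring annihilators
  are generated by idempotents; and \<open>xR = pR\<close> with \<open>p\<close> idempotent gives \<open>x = px \<in> xRx\<close>.
\<close>

lemma right_quasi_morphic_imp_regular:
  assumes "right_quasi_morphic R"
  shows "von_Neumann_regular R"
  unfolding von_Neumann_regular_def
proof
  fix x assume x: "x \<in> carrier R"
  from assms x obtain y where y: "y \<in> carrier R" "x <# carrier R = ann_r R {y}"
    unfolding right_quasi_morphic_def by blast
  obtain p where p: "p \<in> projections R" "x <# carrier R = p <# carrier R"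
    using right_projection_exists[OF y(1)] y(2) by metis
  have "x \<in> x <# carrier R" using x by (auto simp: mem_l_coset intro!: bexI[of _ \<one>])
  then have px: "p \<otimes> x = x" using p x generated_by_projection_iff by simp
  have "p \<in> p <# carrier R" using projectionD[OF p(1)] generated_by_projection_iff[OF p(1)] by simp
  then have "p \<in> x <# carrier R" using p(2) by simp
  then obtain r where r: "r \<in> carrier R" "p = x \<otimes> r" by (auto simp: mem_l_coset)
  then show "\<exists>r\<in>carrier R. x = x \<otimes> r \<otimes> x" using px by metis
qed

text \<open>
  The Baer condition speaks of right annihilators, so the left-hand version goes through the
  involution: \<open>ann\<^sub>l(y)\<close> is the image under \<open>\<star>\<close> of \<open>ann\<^sub>r(y\<^sup>\<star>)\<close>.
\<close>

lemma left_quasi_morphic_imp_regular: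
  assumes "left_quasi_morphic R"
  shows "von_Neumann_regular R"
  unfolding von_Neumann_regular_def
proof
  fix x assume x: "x \<in> carrier R"
  from assms x obtain y where y: "y \<in> carrier R" "carrier R #> x = ann_l R {y}"
    unfolding left_quasi_morphic_def by blast
  obtain p where p: "p \<in> projections R" "ann_r R {y\<^sup>\<star>} = p <# carrier R"
    using right_projection_exists[OF star_closed[OF y(1)]] by metis
  note pD = projectionD[OF p(1)]
  have star_ann: "a \<in> carrier R #> x \<longleftrightarrow> p \<otimes> a\<^sup>\<star> = a\<^sup>\<star>" if a: "a \<in> carrier R" for a
  proof -
    have "a \<in> carrier R #> x \<longleftrightarrow> a \<otimes> y = \<zero>" using a y by (simp add: ann_l_def)
    also have "\<dots> \<longleftrightarrow> y\<^sup>\<star> \<otimes> a\<^sup>\<star> = \<zero>"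
      using a y(1) star_inj[of "a \<otimes> y" \<zero>] by (auto simp flip: star_mult)
    also have "\<dots> \<longleftrightarrow> a\<^sup>\<star> \<in> p <# carrier R"
      using a star_closed by (simp flip: p(2) add: ann_r_def)
    finally show ?thesis using generated_by_projection_iff[OF p(1)] star_closed[OF a] by simp
  qed
  have "x \<in> carrier R #> x" using x by (auto simp: r_coset_def intro!: bexI[of _ \<one>])
  then have "p \<otimes> x\<^sup>\<star> = x\<^sup>\<star>" using star_ann x by blast
  then have xp: "x \<otimes> p = x"
    using x pD star_mult[of p "x\<^sup>\<star>"] by (simp add: star_simps)
  have "p \<in> carrier R #> x" using star_ann pD by simp
  then obtain r where "r \<in> carrier R" "p = r \<otimes> x" by (auto simp: r_coset_def)
  then show "\<exists>r\<in>carrier R. x = x \<otimes> r \<otimes> x" using xp x by (metis m_assoc)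
qed

end


section \<open>Polar decomposition and unit-regularity\<close>

context Baer_star_ring
begin

lemma partial_isometryD:
  assumes "w \<in> partial_isometries R"
  shows "w \<in> carrier R" "w \<otimes> (w\<^sup>\<star> \<otimes> w) = w" "w\<^sup>\<star> \<otimes> w \<in> projections R" "w \<otimes> w\<^sup>\<star> \<in> projections R"
proof -
  show w: "w \<in> carrier R" and www: "w \<otimes> (w\<^sup>\<star> \<otimes> w) = w"
    using assms by (auto simp: partial_isometries_def m_assoc star_closed)
  have "w\<^sup>\<star> \<otimes> w \<otimes> (w\<^sup>\<star> \<otimes> w) = w\<^sup>\<star> \<otimes> w"
    using w www by (simp add: m_assoc star_closed)
  moreover have "w \<otimes> w\<^sup>\<star> \<otimes> (w \<otimes> w\<^sup>\<star>) = w \<otimes> (w\<^sup>\<star> \<otimes> w) \<otimes> w\<^sup>\<star>"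
    using w by (simp add: m_assoc star_closed)
  ultimately show "w\<^sup>\<star> \<otimes> w \<in> projections R" "w \<otimes> w\<^sup>\<star> \<in> projections R"
    using w www by (auto simp: projections_def star_simps)
qed

text \<open>
  For \<open>p = w\<^sup>\<star>w\<close> a projection, the element \<open>y = w(1 - p)\<close> has \<open>y\<^sup>\<star>y = (1 - p)p(1 - p) = 0\<close>, so it vanishes
  because the involution is proper.
\<close>

lemma partial_isometryI:
  assumes w: "w \<in> carrier R" and p: "w\<^sup>\<star> \<otimes> w \<in> projections R"
  shows "w \<in> partial_isometries R"
proof -
  let ?p = "w\<^sup>\<star> \<otimes> w"
  note pD = projectionD[OF p]
  have "?p \<otimes> (\<one> \<ominus> ?p) = \<zero>"
    using pD by (simp add: minus_eq r_distr r_minus r_neg)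
  then have "w \<otimes> (\<one> \<ominus> ?p) = \<zero>" using square_mult_zero_iff w pD(1) by simp
  then have "w \<ominus> w \<otimes> ?p = \<zero>" using w pD(1) by (simp add: minus_eq r_distr r_minus)
  then have "w \<otimes> ?p = w" using w pD(1) by simp
  then show ?thesis using w by (simp add: partial_isometries_def m_assoc star_closed)
qed

lemma double_commutant_commute:
  assumes y: "y \<in> commutant R (commutant R {x})" and x: "x \<in> carrier R"
  shows "y \<in> carrier R" "x \<otimes> y = y \<otimes> x"
    "\<And>z. z \<in> carrier R \<Longrightarrow> x \<otimes> z = z \<otimes> x \<Longrightarrow> z \<otimes> y = y \<otimes> z"
  using assms by (auto simp: commutant_def)

text \<open>
  With \<open>r = (x\<^sup>\<star>x)\<^sup>1\<^sup>/\<^sup>2\<close> and \<open>e\<close> the right projection of \<open>x\<close>, which is also that of \<open>r\<close>, regularity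
  makes \<open>r\<close> invertible in the corner \<open>eRe\<close>.  Its inverse \<open>s\<close> there turns \<open>x\<close> into the partial isometry
  \<open>v = xs\<close> with initial projection \<open>e\<close>, and \<open>x = vr\<close>.
\<close>

lemma polar_decomposition:
  assumes reg: "von_Neumann_regular R" and UPSR: "axiom_UPSR R" and x: "x \<in> carrier R"
  obtains v r s where "v \<in> partial_isometries R" "r \<in> carrier R" "s \<in> carrier R" "x = v \<otimes> r"
    "r \<otimes> s = v\<^sup>\<star> \<otimes> v" "s \<otimes> r = v\<^sup>\<star> \<otimes> v"
    "(v\<^sup>\<star> \<otimes> v) \<otimes> r = r" "r \<otimes> (v\<^sup>\<star> \<otimes> v) = r" "(v\<^sup>\<star> \<otimes> v) \<otimes> s = s" "s \<otimes> (v\<^sup>\<star> \<otimes> v) = s"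
proof -
  obtain r where rr: "r \<otimes> r = x\<^sup>\<star> \<otimes> x" and pos: "star_positive R r"
    using UPSR star_positive_square[OF x] unfolding axiom_UPSR_def by metis
  have r: "r \<in> carrier R" "r\<^sup>\<star> = r" using star_positive_self_adjoint[OF pos] by auto
  have same_ann: "x \<otimes> y = \<zero> \<longleftrightarrow> r \<otimes> y = \<zero>" if "y \<in> carrier R" for y
    using square_mult_zero_iff[OF x that] square_mult_zero_iff[OF r(1) that] rr r by simp
  obtain q where q: "q \<in> projections R" "ann_r R {r} = q <# carrier R"
    using right_projection_exists[OF r(1)] by blast
  define e where "e = \<one> \<ominus> q"
  have e: "e \<in> projections R" using q projection_complement by (simp add: e_def)
  note qD = projectionD[OF q(1)] and eD = projectionD[OF e]
  have ann_e: "e \<otimes> y = \<zero>" if "y \<in> carrier R" "r \<otimes> y = \<zero>" for y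
  proof -
    have "y \<in> ann_r R {r}" using that by (simp add: ann_r_def)
    then have "q \<otimes> y = y" using q generated_by_projection_iff that by simp
    then show ?thesis using that qD by (simp add: e_def minus_eq l_distr l_minus r_neg)
  qed
  have "q \<in> ann_r R {r}" using q generated_by_projection_iff qD by simp
  then have rq: "r \<otimes> q = \<zero>" by (simp add: ann_r_def)
  have re: "r \<otimes> e = r" "x \<otimes> e = x"
    using rq same_ann[of q] r x qD by (simp_all add: e_def minus_eq r_distr r_minus)
  have er: "e \<otimes> r = r" using star_mult[of r e] r eD re by simp
  obtain a where a: "a \<in> carrier R" "r = r \<otimes> a \<otimes> r"
    using reg r unfolding von_Neumann_regular_def by blast
  \<comment> \<open>compressing any inner inverse \<open>a\<close> of \<open>r\<close> to the corner \<open>eRe\<close> gives the inverse of \<open>r\<close> there\<close>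
  define s where "s = e \<otimes> a \<otimes> e"
  have "r \<otimes> (\<one> \<ominus> a \<otimes> r) = \<zero>" using r a by (simp add: minus_eq r_distr r_minus r_neg flip: m_assoc)
  then have "e \<otimes> (\<one> \<ominus> a \<otimes> r) = \<zero>" using ann_e r a by simp
  then have "e \<ominus> e \<otimes> (a \<otimes> r) = \<zero>" using r a eD by (simp add: minus_eq r_distr r_minus)
  then have ear: "e \<otimes> (a \<otimes> r) = e" using r a eD by simp
  then have ras: "r \<otimes> (a\<^sup>\<star> \<otimes> e) = e"
    using star_mult[of e "a \<otimes> r"] r a eD by (simp add: star_simps m_assoc)
  have sr: "s \<otimes> r = e" using er ear a r eD by (simp add: s_def m_assoc)
  have "s = e \<otimes> a \<otimes> (r \<otimes> (a\<^sup>\<star> \<otimes> e))" using ras by (simp add: s_def)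
  also have "\<dots> = (e \<otimes> (a \<otimes> r)) \<otimes> (a\<^sup>\<star> \<otimes> e)" using a r eD by (simp add: star_closed m_assoc)
  finally have s_eq: "s = e \<otimes> a\<^sup>\<star> \<otimes> e" using ear a eD by (simp add: star_closed m_assoc)
  have s: "s \<in> carrier R" "s\<^sup>\<star> = s"
  proof -
    show "s \<in> carrier R" using a eD by (simp add: s_def)
    have "s\<^sup>\<star> = e \<otimes> a\<^sup>\<star> \<otimes> e" using a eD by (simp add: s_def star_simps m_assoc)
    then show "s\<^sup>\<star> = s" using s_eq by simp
  qed
  have rs: "r \<otimes> s = e" using star_mult[of s r] s r sr eD by simp
  have es: "e \<otimes> s = s" "s \<otimes> e = s"
    using a eD by (simp_all add: s_def flip: m_assoc) (simp add: m_assoc eD)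
  define v where "v = x \<otimes> s"
  have v: "v \<in> carrier R" using x s by (simp add: v_def)
  have "v\<^sup>\<star> \<otimes> v = s \<otimes> (x\<^sup>\<star> \<otimes> x) \<otimes> s"
    using x s by (simp add: v_def star_simps m_assoc)
  also have "\<dots> = (s \<otimes> r) \<otimes> (r \<otimes> s)"
    using r s by (simp flip: rr add: m_assoc)
  finally have vv: "v\<^sup>\<star> \<otimes> v = e" using sr rs eD by simp
  have "x = v \<otimes> r" using re sr x s r by (simp add: v_def m_assoc)
  moreover have "v \<in> partial_isometries R" using partial_isometryI v vv e by simp
  ultimately show ?thesis using that[of v r s] r s rs sr re er es unfolding vv by blast
qed

text \<open>
  Let \<open>e\<close> and \<open>f\<close> be the initial and final projections of \<open>v\<close>.  By Zorn's lemma there is a maximal orthogonal family of partial isometries from subprojections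
  of \<open>1 - e\<close> to subprojections of \<open>1 - f\<close>; adding them up and adding \<open>v\<close> gives a partial isometry \<open>t\<close>
  with initial projection \<open>1 - g\<close> and final projection \<open>1 - h\<close>.  By (EP) a nonzero element of \<open>hRg\<close>
  would produce one more member of the family, so \<open>hRg = 0\<close>.  Then the projection \<open>c\<close> generating
  the annihilator of \<open>hR\<close> is central, with \<open>cg = g\<close> and \<open>ch = 0\<close>.  Hence \<open>t\<^sup>\<star>c + (1 - c)\<close> is an
  isometry, and finiteness makes it unitary, which says \<open>g = 0\<close>.  Finally \<open>t\<close> itself is an isometry,
  hence unitary.
\<close>

lemma unitary_extension:
  assumes A1: "axiom_A1 R" and EP: "axiom_EP R" and A3: "axiom_A3 R"
    and v: "v \<in> partial_isometries R"
  obtains t where "t \<in> unitaries R" "t \<otimes> (v\<^sup>\<star> \<otimes> v) = v"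
proof -
  define e where "e = v\<^sup>\<star> \<otimes> v"
  define f where "f = v \<otimes> v\<^sup>\<star>"
  have e: "e \<in> projections R" and f: "f \<in> projections R"
    using partial_isometryD[OF v] by (auto simp: e_def f_def)
  note vC = partial_isometryD(1)[OF v] and eD = projectionD[OF e] and fD = projectionD[OF f]
  have ve: "v \<otimes> e = v" and fv: "f \<otimes> v = v"
    using partial_isometryD[OF v] by (simp_all add: e_def f_def m_assoc star_closed)
  have stars: "e \<otimes> v\<^sup>\<star> = v\<^sup>\<star>" "v\<^sup>\<star> \<otimes> f = v\<^sup>\<star>"
    using star_mult[of v e] star_mult[of f v] ve fv vC eD fD by simp_all
  let ?init = "\<lambda>u. u\<^sup>\<star> \<otimes> u" and ?final = "\<lambda>u. u \<otimes> u\<^sup>\<star>"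
  define F where "F = {W. W \<subseteq> {w \<in> partial_isometries R. w \<otimes> e = \<zero> \<and> f \<otimes> w = \<zero>} \<and>
    pairwise (\<lambda>u w. ?init u \<otimes> ?init w = \<zero>) W \<and> pairwise (\<lambda>u w. ?final u \<otimes> ?final w = \<zero>) W}"
  have "\<exists>M\<in>F. \<forall>X\<in>F. M \<subseteq> X \<longrightarrow> X = M"
  proof (rule Zorn_Lemma, rule ballI)
    fix C assume C: "C \<in> chains F"
    then have chain: "chain\<^sub>\<subseteq> C" and CF: "C \<subseteq> F" by (auto simp: chains_def)
    show "\<Union>C \<in> F"
      unfolding F_def
      using CF by (intro CollectI conjI pairwise_chain_Union[OF _ chain]) (auto simp: F_def)
  qed
  then obtain M where M: "M \<in> F" and max: "\<And>X. X \<in> F \<Longrightarrow> M \<subseteq> X \<Longrightarrow> X = M" by blast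
  have MD: "u \<in> partial_isometries R" "u \<otimes> e = \<zero>" "f \<otimes> u = \<zero>" if "u \<in> M" for u
    using M that by (auto simp: F_def)
  obtain w where w: "w \<in> partial_isometries R"
    and sup_init: "is_proj_sup R (?init w) (?init ` M)"
    and sup_final: "is_proj_sup R (?final w) (?final ` M)"
    using A3 M unfolding axiom_A3_def F_def by blast
  define e' where "e' = w\<^sup>\<star> \<otimes> w"
  define f' where "f' = w \<otimes> w\<^sup>\<star>"
  have e': "e' \<in> projections R" and f': "f' \<in> projections R"
    using partial_isometryD[OF w] by (auto simp: e'_def f'_def)
  note wC = partial_isometryD(1)[OF w] and e'D = projectionD[OF e'] and f'D = projectionD[OF f']
  have init_proj: "?init ` M \<subseteq> projections R" and final_proj: "?final ` M \<subseteq> projections R"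
    using MD partial_isometryD by auto
  have e'e: "e' \<otimes> e = \<zero>"
    unfolding e'_def
  proof (rule proj_sup_orthogonal[OF sup_init init_proj e])
    fix p assume "p \<in> ?init ` M"
    then obtain u where "u \<in> M" "p = ?init u" by blast
    then show "p \<otimes> e = \<zero>"
      using MD(2)[of u] partial_isometryD(1)[OF MD(1)[of u]] eD(1) by (simp add: m_assoc star_closed)
  qed
  have f'f: "f' \<otimes> f = \<zero>"
    unfolding f'_def
  proof (rule proj_sup_orthogonal[OF sup_final final_proj f])
    fix p assume "p \<in> ?final ` M"
    then obtain u where u: "u \<in> M" "p = ?final u" by blast
    then have uC: "u \<in> carrier R" using MD partial_isometryD(1) by blast
    then have "u\<^sup>\<star> \<otimes> f = \<zero>" using star_mult[of f u] MD(3)[OF u(1)] fD by simp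
    then show "p \<otimes> f = \<zero>" using u uC fD(1) by (simp add: m_assoc star_closed)
  qed
  have we: "w \<otimes> e = \<zero>" using e'e square_mult_zero_iff[OF wC eD(1)] by (simp add: e'_def)
  have wsf: "w\<^sup>\<star> \<otimes> f = \<zero>"
    using f'f square_mult_zero_iff[OF star_closed[OF wC] fD(1)] wC by (simp add: f'_def star_star)
  have ews: "e \<otimes> w\<^sup>\<star> = \<zero>" using star_mult[of w e] we wC eD by simp
  have fw: "f \<otimes> w = \<zero>" using star_mult[of "w\<^sup>\<star>" f] wsf wC fD by (simp add: star_simps)
  define t where "t = v \<oplus> w"
  have t: "t \<in> carrier R" "t\<^sup>\<star> = v\<^sup>\<star> \<oplus> w\<^sup>\<star>" using vC wC by (simp_all add: t_def star_add)
  have cross: "v\<^sup>\<star> \<otimes> w = \<zero>" "w\<^sup>\<star> \<otimes> v = \<zero>" "v \<otimes> w\<^sup>\<star> = \<zero>" "w \<otimes> v\<^sup>\<star> = \<zero>"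
  proof -
    have "(v\<^sup>\<star> \<otimes> f) \<otimes> w = \<zero>" "(w\<^sup>\<star> \<otimes> f) \<otimes> v = \<zero>" "(v \<otimes> e) \<otimes> w\<^sup>\<star> = \<zero>" "(w \<otimes> e) \<otimes> v\<^sup>\<star> = \<zero>"
      using vC wC eD(1) fD(1) fw wsf ews we
      by (simp_all add: star_closed m_assoc)
    then show "v\<^sup>\<star> \<otimes> w = \<zero>" "w\<^sup>\<star> \<otimes> v = \<zero>" "v \<otimes> w\<^sup>\<star> = \<zero>" "w \<otimes> v\<^sup>\<star> = \<zero>"
      using stars ve vC wC eD(1) fD(1) fv
      by (simp_all add: star_closed m_assoc)
  qed
  define g where "g = \<one> \<ominus> (e \<oplus> e')"
  define h where "h = \<one> \<ominus> (f \<oplus> f')"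
  have tt: "t\<^sup>\<star> \<otimes> t = e \<oplus> e'" "t \<otimes> t\<^sup>\<star> = f \<oplus> f'"
    using vC wC cross unfolding t
    by (simp_all add: t_def star_closed l_distr r_distr e_def e'_def f_def f'_def)
  have "e \<oplus> e' \<in> projections R" "f \<oplus> f' \<in> projections R"
    using orthogonal_projections_sum e e' f f' e'e f'f by (simp_all add: projections_orthogonal_commute)
  then have g: "g \<in> projections R" and h: "h \<in> projections R"
    by (simp_all add: g_def h_def projection_complement)
  note gD = projectionD[OF g] and hD = projectionD[OF h]
  have ge: "g \<otimes> e = \<zero>" and g_below: "e' \<otimes> g = \<zero>" and fh: "f \<otimes> h = \<zero>" and h_below: "f' \<otimes> h = \<zero>"
    using eD e'D fD f'D e'e f'f projections_orthogonal_commute[OF e' e e'e]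
      projections_orthogonal_commute[OF f' f f'f]
    by (simp_all add: g_def h_def minus_eq minus_add l_distr r_distr l_minus r_minus r_neg r_neg2 a_ac add_cancel_middle)

  have no_link: "h \<otimes> a \<otimes> g = \<zero>" if a: "a \<in> carrier R" for a
  proof (rule ccontr)
    define z where "z = h \<otimes> a \<otimes> g"
    assume "h \<otimes> a \<otimes> g \<noteq> \<zero>"
    then have "z \<noteq> \<zero>" by (simp add: z_def)
    have z: "z \<in> carrier R" "z \<otimes> g = z" "h \<otimes> z = z"
      using a gD hD by (simp_all add: z_def m_assoc) (simp_all add: hD flip: m_assoc)
    obtain y where y: "y \<in> commutant R (commutant R {z\<^sup>\<star> \<otimes> z})" "y\<^sup>\<star> = y"
      "z\<^sup>\<star> \<otimes> z \<otimes> (y \<otimes> y) \<in> projections R" "z\<^sup>\<star> \<otimes> z \<otimes> (y \<otimes> y) \<noteq> \<zero>"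
      using EP z(1) \<open>z \<noteq> \<zero>\<close> unfolding axiom_EP_def by blast
    have zz: "z\<^sup>\<star> \<otimes> z \<in> carrier R" using z by (simp add: star_closed)
    note yD = double_commutant_commute[OF y(1) zz]
    have "g \<otimes> z\<^sup>\<star> = z\<^sup>\<star>" using star_mult[of z g] z gD by simp
    then have "z\<^sup>\<star> \<otimes> z \<otimes> g = g \<otimes> (z\<^sup>\<star> \<otimes> z)"
      using z gD(1) by (simp add: m_assoc star_closed) (simp add: star_closed flip: m_assoc)
    then have gy: "g \<otimes> y = y \<otimes> g" using yD(3) gD(1) by simp
    \<comment> \<open>rescaling by \<open>y\<close> makes \<open>z\<close> a nonzero partial isometry; it stays in \<open>hRg\<close> as \<open>y\<close> commutes with \<open>g\<close>\<close>
    define w0 where "w0 = z \<otimes> y"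
    have w0: "w0 \<in> carrier R" "h \<otimes> w0 = w0"
      using z yD(1) hD(1) by (simp_all add: w0_def flip: m_assoc)
    have "z \<otimes> g \<otimes> y = z \<otimes> y \<otimes> g" using gy z(1) yD(1) gD(1) by (simp add: m_assoc)
    then have w0g: "w0 \<otimes> g = w0" using z by (simp add: w0_def)
    have "w0\<^sup>\<star> \<otimes> w0 = y \<otimes> (z\<^sup>\<star> \<otimes> z) \<otimes> y"
      using z y(2) yD(1) by (simp add: w0_def star_simps m_assoc)
    also have "\<dots> = z\<^sup>\<star> \<otimes> z \<otimes> (y \<otimes> y)"
      using yD(1) zz by (simp flip: yD(2) add: m_assoc)
    finally have init_w0: "w0\<^sup>\<star> \<otimes> w0 \<in> projections R" "w0\<^sup>\<star> \<otimes> w0 \<noteq> \<zero>" using y by simp_all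
    have pi_w0: "w0 \<in> partial_isometries R" using partial_isometryI w0 init_w0 by simp
    have gw0: "g \<otimes> w0\<^sup>\<star> = w0\<^sup>\<star>" using star_mult[of w0 g] w0g w0 gD by simp
    have orth_init: "?init u \<otimes> ?init w0 = \<zero>" if u: "u \<in> M" for u
    proof -
      have uC: "?init u \<in> projections R" using u init_proj by blast
      note uD = projectionD[OF uC]
      have "?init u \<otimes> e' = ?init u" unfolding e'_def
        using is_proj_supD(2)[OF sup_init init_proj] u by blast
      then have "?init u \<otimes> g = \<zero>" using g_below e'D(1) gD(1) uD(1) by (metis m_assoc r_null)
      then have "?init u \<otimes> (g \<otimes> w0\<^sup>\<star>) = \<zero>"
        using uD(1) gD(1) w0(1) star_closed by (metis m_assoc l_null)
      then have "?init u \<otimes> w0\<^sup>\<star> = \<zero>" using gw0 by simp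
      then show ?thesis using uD(1) w0(1) star_closed by (metis m_assoc l_null)
    qed
    have orth_final: "?final u \<otimes> ?final w0 = \<zero>" if u: "u \<in> M" for u
    proof -
      have uC: "?final u \<in> projections R" using u final_proj by blast
      note uD = projectionD[OF uC]
      have "?final u \<otimes> f' = ?final u" unfolding f'_def
        using is_proj_supD(2)[OF sup_final final_proj] u by blast
      then have "?final u \<otimes> h = \<zero>" using h_below f'D(1) hD(1) uD(1) by (metis m_assoc r_null)
      then have "?final u \<otimes> (h \<otimes> w0) = \<zero>" using uD(1) hD(1) w0(1) by (metis m_assoc l_null)
      then have "?final u \<otimes> w0 = \<zero>" using w0 by simp
      then show ?thesis using uD(1) w0(1) star_closed by (metis m_assoc l_null)
    qed
    have "w0 \<otimes> e = \<zero>"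
      using ge w0g w0(1) gD(1) eD(1) by (metis m_assoc r_null)
    moreover have "f \<otimes> w0 = \<zero>"
      using fh w0 hD(1) fD(1) by (metis m_assoc l_null)
    moreover have "?init w0 \<otimes> ?init u = \<zero>" "?final w0 \<otimes> ?final u = \<zero>" if "u \<in> M" for u
      using that init_proj final_proj
        projections_orthogonal_commute[OF _ partial_isometryD(3)[OF pi_w0] orth_init[OF that]]
        projections_orthogonal_commute[OF _ partial_isometryD(4)[OF pi_w0] orth_final[OF that]]
      by blast+
    ultimately have "insert w0 M \<in> F"
      using M pi_w0 orth_init orth_final unfolding F_def
      by (auto simp: pairwise_insert)
    then have "w0 \<in> M" using max by blast
    then have "?init w0 \<otimes> ?init w0 = \<zero>" using orth_init by blast
    then show False using init_w0 projectionD(3) by metis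
  qed

  obtain c where c: "c \<in> projections R" and ann: "ann_r R ((\<lambda>a. h \<otimes> a) ` carrier R) = c <# carrier R"
    using ann_r_generated[of "(\<lambda>a. h \<otimes> a) ` carrier R"] hD(1) by auto
  note cD = projectionD[OF c]
  have c_iff: "c \<otimes> y = y \<longleftrightarrow> (\<forall>a\<in>carrier R. h \<otimes> a \<otimes> y = \<zero>)" if "y \<in> carrier R" for y
    using generated_by_projection_iff[OF c that] that unfolding ann[symmetric] by (simp add: ann_r_def)
  have cg: "c \<otimes> g = g" using c_iff gD(1) no_link by blast
  have hac: "h \<otimes> a \<otimes> c = \<zero>" if "a \<in> carrier R" for a using c_iff[OF cD(1)] cD that by blast
  have cbc: "c \<otimes> (b \<otimes> c) = b \<otimes> c" if b: "b \<in> carrier R" for b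
  proof -
    have "h \<otimes> a \<otimes> (b \<otimes> c) = h \<otimes> (a \<otimes> b) \<otimes> c" if "a \<in> carrier R" for a
      using that b hD(1) cD(1) by (simp add: m_assoc)
    then show ?thesis using c_iff[of "b \<otimes> c"] hac b cD(1) by simp
  qed
  \<comment> \<open>\<open>cR\<close> is a two-sided ideal, and applying the involution to \<open>cb\<^sup>\<star>c = b\<^sup>\<star>c\<close> gives \<open>cbc = cb\<close>\<close>
  have central: "b \<otimes> c = c \<otimes> b" if b: "b \<in> carrier R" for b
  proof -
    have "(c \<otimes> (b\<^sup>\<star> \<otimes> c))\<^sup>\<star> = (b\<^sup>\<star> \<otimes> c)\<^sup>\<star>" using cbc b by (simp add: star_closed)
    then have "c \<otimes> b \<otimes> c = c \<otimes> b" using b cD by (simp add: star_simps)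
    then show ?thesis using cbc[OF b] b cD(1) by (simp add: m_assoc)
  qed
  have hc: "h \<otimes> c = \<zero>" using hac[of \<one>] hD(1) by simp
  define d where "d = \<one> \<ominus> c"
  have d: "d \<in> projections R" using c projection_complement by (simp add: d_def)
  note dD = projectionD[OF d]
  have cd: "c \<otimes> d = \<zero>" "d \<otimes> c = \<zero>" "c \<oplus> d = \<one>"
    using cD by (simp_all add: d_def minus_eq l_distr r_distr l_minus r_minus r_neg add_cancel_middle)
  define s where "s = t\<^sup>\<star> \<otimes> c \<oplus> d"
  have tC: "t\<^sup>\<star> \<in> carrier R" by (rule star_closed[OF t(1)])
  have s: "s \<in> carrier R" "s\<^sup>\<star> = c \<otimes> t \<oplus> d"
    using t(1) tC cD dD by (simp_all add: s_def star_simps)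
  have tcd: "d \<otimes> (t\<^sup>\<star> \<otimes> c) = \<zero>" "c \<otimes> t \<otimes> d = \<zero>"
  proof -
    have "d \<otimes> (t\<^sup>\<star> \<otimes> c) = (d \<otimes> c) \<otimes> t\<^sup>\<star>" using central[OF tC] tC cD(1) dD(1) by (simp add: m_assoc)
    then show "d \<otimes> (t\<^sup>\<star> \<otimes> c) = \<zero>" using cd tC by simp
    have "c \<otimes> t \<otimes> d = t \<otimes> (c \<otimes> d)" using central[OF t(1)] t(1) cD(1) dD(1) by (simp flip: m_assoc)
    then show "c \<otimes> t \<otimes> d = \<zero>" using cd t(1) by simp
  qed
  have "s\<^sup>\<star> \<otimes> s = c \<otimes> (t \<otimes> t\<^sup>\<star>) \<otimes> c \<oplus> d"
    using t(1) tC cD(1) dD tcd unfolding s(2) by (simp add: s_def l_distr r_distr m_assoc)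
  also have "c \<otimes> (t \<otimes> t\<^sup>\<star>) \<otimes> c = c"
  proof -
    have "t \<otimes> t\<^sup>\<star> = \<one> \<ominus> h"
      using fD(1) f'D(1) by (simp add: tt h_def minus_eq minus_add r_neg2 a_assoc l_neg)
    then have "t \<otimes> t\<^sup>\<star> \<otimes> c = c" using hc cD hD(1) by (simp add: minus_eq l_distr l_minus)
    then show ?thesis using t(1) tC cD by (simp add: m_assoc)
  qed
  finally have "s\<^sup>\<star> \<otimes> s = \<one>" using cd by simp
  then have "s \<otimes> s\<^sup>\<star> = \<one>" using A1 s unfolding axiom_A1_def by blast
  moreover have "s \<otimes> s\<^sup>\<star> = t\<^sup>\<star> \<otimes> t \<otimes> c \<oplus> d"
  proof -
    have "t\<^sup>\<star> \<otimes> c \<otimes> (c \<otimes> t) = t\<^sup>\<star> \<otimes> (c \<otimes> c) \<otimes> t" using t(1) tC cD(1) by (simp add: m_assoc)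
    also have "\<dots> = t\<^sup>\<star> \<otimes> t \<otimes> c" using t(1) tC cD by (simp add: m_assoc central[OF t(1)])
    finally have "t\<^sup>\<star> \<otimes> c \<otimes> (c \<otimes> t) = t\<^sup>\<star> \<otimes> t \<otimes> c" .
    moreover have "t\<^sup>\<star> \<otimes> c \<otimes> d = \<zero>" "d \<otimes> (c \<otimes> t) = \<zero>"
      using t(1) tC cD(1) dD(1) cd by (simp add: m_assoc) (simp add: cd t(1) cD dD flip: m_assoc)
    ultimately show ?thesis
      using t(1) tC cD(1) dD unfolding s(2) by (simp add: s_def l_distr r_distr)
  qed
  moreover have "t\<^sup>\<star> \<otimes> t = \<one> \<ominus> g"
    using eD(1) e'D(1) by (simp add: tt g_def minus_eq minus_add r_neg2 a_assoc l_neg)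
  ultimately have "c \<ominus> g \<oplus> d = c \<oplus> d"
    using central[OF gD(1)] cg cd gD(1) cD(1) by (simp add: minus_eq l_distr l_minus)
  then have "c \<ominus> g = c" using gD(1) cD(1) dD(1) by simp
  then have "g = \<zero>" using gD(1) cD(1) by (metis minus_closed add_diff_cancel_carrier add.r_cancel_one)
  then have "t\<^sup>\<star> \<otimes> t = \<one>" using \<open>t\<^sup>\<star> \<otimes> t = \<one> \<ominus> g\<close> by (simp add: minus_eq)
  moreover from this have "t \<otimes> t\<^sup>\<star> = \<one>" using A1 t(1) unfolding axiom_A1_def by blast
  ultimately have "t \<in> unitaries R" using t(1) by (simp add: unitaries_def)
  moreover have "t \<otimes> e = v" using ve we vC wC eD(1) by (simp add: t_def l_distr)
  ultimately show ?thesis using that unfolding e_def by blast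
qed

text \<open>
  The polar factors \<open>v\<close> and \<open>r\<close> of \<open>x\<close> extend to units: \<open>v\<close> to a unitary \<open>t\<close>, and \<open>r\<close>, which is
  invertible in \<open>eRe\<close>, to \<open>r + (1 - e)\<close>.  The inverse of \<open>t(r + (1 - e))\<close> is an inner inverse of \<open>x\<close>.
\<close>

lemma regular_imp_unit_regular:
  assumes A1: "axiom_A1 R" and A2: "axiom_A2 R" and A3: "axiom_A3 R"
    and reg: "von_Neumann_regular R"
  shows "unit_regular R"
  unfolding unit_regular_def
proof
  fix x assume x: "x \<in> carrier R"
  have EP: "axiom_EP R" and UPSR: "axiom_UPSR R" using A2 by (auto simp: axiom_A2_def)
  obtain v r s where v: "v \<in> partial_isometries R" and rs: "r \<in> carrier R" "s \<in> carrier R"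
    and polar: "x = v \<otimes> r" "r \<otimes> s = v\<^sup>\<star> \<otimes> v" "s \<otimes> r = v\<^sup>\<star> \<otimes> v"
    "(v\<^sup>\<star> \<otimes> v) \<otimes> r = r" "r \<otimes> (v\<^sup>\<star> \<otimes> v) = r" "(v\<^sup>\<star> \<otimes> v) \<otimes> s = s" "s \<otimes> (v\<^sup>\<star> \<otimes> v) = s"
    by (rule polar_decomposition[OF reg UPSR x])
  define e where "e = v\<^sup>\<star> \<otimes> v"
  note polar' = polar[folded e_def]
  have e: "e \<in> projections R" using partial_isometryD[OF v] by (simp add: e_def)
  obtain t where t: "t \<in> unitaries R" "t \<otimes> e = v"
    using unitary_extension[OF A1 EP A3 v] unfolding e_def by blast
  have tC: "t \<in> carrier R" "t\<^sup>\<star> \<in> carrier R" "t\<^sup>\<star> \<otimes> t = \<one>" "t \<otimes> t\<^sup>\<star> = \<one>"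
    using t star_closed by (auto simp: unitaries_def)
  define p where "p = \<one> \<ominus> e"
  have p: "p \<in> projections R" using e projection_complement by (simp add: p_def)
  note eD = projectionD[OF e] and pD = projectionD[OF p]
  have p_zero: "p \<otimes> r = \<zero>" "r \<otimes> p = \<zero>" "p \<otimes> s = \<zero>" "s \<otimes> p = \<zero>" "e \<oplus> p = \<one>"
    using polar' rs eD
    by (simp_all add: p_def minus_eq l_distr r_distr l_minus r_minus r_neg add_cancel_middle)
  have units: "(r \<oplus> p) \<otimes> (s \<oplus> p) = \<one>" "(s \<oplus> p) \<otimes> (r \<oplus> p) = \<one>"
    using p_zero polar' rs eD(1) pD by (simp_all add: l_distr r_distr)
  define y where "y = (s \<oplus> p) \<otimes> t\<^sup>\<star>"
  have y: "y \<in> carrier R" using rs pD tC by (simp add: y_def)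
  have "y \<otimes> (t \<otimes> (r \<oplus> p)) = (s \<oplus> p) \<otimes> (t\<^sup>\<star> \<otimes> t) \<otimes> (r \<oplus> p)"
    using rs pD(1) tC(1,2) by (simp add: y_def m_assoc)
  then have inv1: "y \<otimes> (t \<otimes> (r \<oplus> p)) = \<one>" using units tC rs pD(1) by simp
  have "(t \<otimes> (r \<oplus> p)) \<otimes> y = t \<otimes> ((r \<oplus> p) \<otimes> (s \<oplus> p)) \<otimes> t\<^sup>\<star>"
    using rs pD(1) tC(1,2) by (simp add: y_def m_assoc)
  then have inv2: "(t \<otimes> (r \<oplus> p)) \<otimes> y = \<one>" using units tC by simp
  have "y \<in> Units R"
    using y inv1 inv2 rs pD(1) tC(1) by (auto intro: Units_one_sidedI)
  moreover have "x = x \<otimes> y \<otimes> x"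
  proof -
    have "t \<otimes> r = t \<otimes> (e \<otimes> r)" using polar' by simp
    also have "\<dots> = x" using t(2) polar'(1) rs(1) eD(1) tC(1) by (metis m_assoc)
    finally have x_eq: "x = t \<otimes> r" by simp
    have "x \<otimes> y \<otimes> x = t \<otimes> (r \<otimes> (s \<oplus> p) \<otimes> (t\<^sup>\<star> \<otimes> t) \<otimes> r)"
      unfolding x_eq using rs pD(1) tC(1,2) by (simp add: y_def m_assoc)
    also have "\<dots> = t \<otimes> (r \<otimes> s \<otimes> r)"
      using rs pD(1) tC p_zero by (simp add: r_distr)
    finally show ?thesis using polar' x_eq by simp
  qed
  ultimately show "\<exists>u\<in>Units R. x = x \<otimes> u \<otimes> x" by blast
qed

end


section \<open>The equivalence\<close>

theorem corollary14:
  fixes R :: "('a, 'm) star_ring_scheme"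
    and Q :: "('b, 'n) star_ring_scheme"
    and \<iota> :: "'a \<Rightarrow> 'b"
  assumes "Baer_star_ring R"
    and "axiom_A1 R" and "axiom_A2 R" and "axiom_A3 R"
    and "axiom_A4 R" and "axiom_A5 R" and "axiom_A6 R"
    and "regular_ring_of R Q \<iota>"
  shows "(\<iota> ` carrier R = carrier Q \<longleftrightarrow> von_Neumann_regular R) \<and>
         (\<iota> ` carrier R = carrier Q \<longleftrightarrow> unit_regular R) \<and>
         (\<iota> ` carrier R = carrier Q \<longleftrightarrow> left_morphic R) \<and>
         (\<iota> ` carrier R = carrier Q \<longleftrightarrow> right_morphic R) \<and>
         (\<iota> ` carrier R = carrier Q \<longleftrightarrow> left_quasi_morphic R) \<and>
         (\<iota> ` carrier R = carrier Q \<longleftrightarrow> right_quasi_morphic R)"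
proof -
  interpret R: Baer_star_ring R by fact
  interpret Q: Baer_star_ring Q using assms(8) by (simp add: regular_ring_of_def)
  have Q: "axiom_A4 Q" "axiom_A5 Q" "von_Neumann_regular Q" "unitaries Q \<subseteq> \<iota> ` carrier R"
    and hom: "\<iota> \<in> ring_hom R Q" and inj: "inj_on \<iota> (carrier R)"
    using assms(8) by (auto simp: regular_ring_of_def axioms_A1_to_A6_def star_ring_embedding_def)
  interpret \<iota>: ring_hom_ring R Q \<iota>
    by (rule ring_hom_ringI2) (fact R.ring_axioms Q.ring_axioms hom)+
  have onto_imp_regular: "von_Neumann_regular R" if onto: "\<iota> ` carrier R = carrier Q"
    unfolding von_Neumann_regular_def
  proof
    fix x assume x: "x \<in> carrier R"
    then obtain b where "b \<in> carrier Q" "\<iota> x = \<iota> x \<otimes>\<^bsub>Q\<^esub> b \<otimes>\<^bsub>Q\<^esub> \<iota> x"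
      using Q(3) unfolding von_Neumann_regular_def by (metis \<iota>.hom_closed)
    then obtain y where y: "y \<in> carrier R" "\<iota> x = \<iota> x \<otimes>\<^bsub>Q\<^esub> \<iota> y \<otimes>\<^bsub>Q\<^esub> \<iota> x"
      using onto by (metis imageE)
    then have "\<iota> x = \<iota> (x \<otimes>\<^bsub>R\<^esub> y \<otimes>\<^bsub>R\<^esub> x)" using x by simp
    then show "\<exists>y\<in>carrier R. x = x \<otimes>\<^bsub>R\<^esub> y \<otimes>\<^bsub>R\<^esub> x"
      using inj x y by (metis R.m_closed inj_onD)
  qed
  \<comment> \<open>inside \<open>Q\<close>, the image of \<open>R\<close> is a regular subring containing the unitaries\<close>
  have regular_imp_onto: "\<iota> ` carrier R = carrier Q" if reg: "von_Neumann_regular R"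
  proof (rule Q.regular_subring_containing_unitaries_eq[OF Q(1,2) _ Q(4)])
    show "subring (\<iota> ` carrier R) Q"
      by (rule \<iota>.img_is_subring[OF R.carrier_is_subring])
    fix a assume "a \<in> \<iota> ` carrier R"
    then obtain x where x: "x \<in> carrier R" "a = \<iota> x" by blast
    then obtain y where y: "y \<in> carrier R" "x = x \<otimes>\<^bsub>R\<^esub> y \<otimes>\<^bsub>R\<^esub> x"
      using reg unfolding von_Neumann_regular_def by blast
    then have "\<iota> x = \<iota> x \<otimes>\<^bsub>Q\<^esub> \<iota> y \<otimes>\<^bsub>Q\<^esub> \<iota> x"
      using x by (metis \<iota>.hom_mult R.m_closed)
    then show "\<exists>b\<in>\<iota> ` carrier R. a = a \<otimes>\<^bsub>Q\<^esub> b \<otimes>\<^bsub>Q\<^esub> a" using x y by blast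
  qed
  have "unit_regular R" if "von_Neumann_regular R"
    using R.regular_imp_unit_regular assms(2-4) that by blast
  then show ?thesis
    using onto_imp_regular regular_imp_onto
      R.unit_regular_imp_left_morphic R.unit_regular_imp_right_morphic
      R.left_morphic_imp_left_quasi_morphic R.right_morphic_imp_right_quasi_morphic
      R.left_quasi_morphic_imp_regular R.right_quasi_morphic_imp_regular
    by blast
qed

end
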